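(* The Globally Minimal Defensive Alliance problem is fixed-parameter tractable when parameterized by the neighbourhood diversity.
   Context: A defensive alliance in a graph $G=(V,E)$ is a non-empty set $S\subseteq V$ such that every $v\in S$ satisfies $d_S(v)+1\geq d_{V\setminus S}(v)$. It is globally minimal if no proper subset is a defensive alliance. Globally Minimal Defensive Alliance: given $G$ and an integer $k\ge 2$, decide whether there is a globally minimal defensive alliance $S$ with $|S|\geq k$. The neighbourhood diversity of $G$ is the least $k$ such that $V$ can be partitioned into $k$ classes where vertices $u,v$ in the same class satisfy $N(u)\setminus\{v\}=N(v)\setminus\{u\}$. *)

theory Defs
  imports Main "HOL-Library.Disjoint_Sets"
begin

section \<open>Defensive alliances and neighbourhood diversity\<close>

definition simple_graph :: "'a set \<Rightarrow> 'a set set \<Rightarrow> bool" where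
  "simple_graph V E \<longleftrightarrow> finite V \<and> E \<subseteq> {{u, v} |u v. u \<in> V \<and> v \<in> V \<and> u \<noteq> v}"

definition neighbours :: "'a set set \<Rightarrow> 'a \<Rightarrow> 'a set" where
  "neighbours E v = {u. {u, v} \<in> E}"

definition degree_in :: "'a set set \<Rightarrow> 'a set \<Rightarrow> 'a \<Rightarrow> nat" where
  "degree_in E S v = card (neighbours E v \<inter> S)"

definition defensive_alliance :: "'a set \<Rightarrow> 'a set set \<Rightarrow> 'a set \<Rightarrow> bool" where
  "defensive_alliance V E S \<longleftrightarrow>
     S \<noteq> {} \<and> S \<subseteq> V \<and> (\<forall>v\<in>S. degree_in E S v + 1 \<ge> degree_in E (V - S) v)"

definition globally_minimal_defensive_alliance :: "'a set \<Rightarrow> 'a set set \<Rightarrow> 'a set \<Rightarrow> bool" where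
  "globally_minimal_defensive_alliance V E S \<longleftrightarrow>
     defensive_alliance V E S \<and> (\<forall>T. T \<subset> S \<longrightarrow> \<not> defensive_alliance V E T)"

definition neighbourhood_diversity :: "'a set \<Rightarrow> 'a set set \<Rightarrow> nat" where
  "neighbourhood_diversity V E =
     (LEAST k. \<exists>P. partition_on V P \<and> finite P \<and> card P = k \<and>
        (\<forall>C\<in>P. \<forall>u\<in>C. \<forall>v\<in>C. neighbours E u - {v} = neighbours E v - {u}))"


section \<open>Model of computation\<close>

text \<open>
  Algorithms are programs of first-order pure LISP: call-by-value, mutually recursive functions on
  binary trees, with unit-cost pairing, projections, test for a leaf, and function call. Values are
  shared and never copied or compared as a whole, so a fixed program is simulated by a pointer
  machine (hence by a RAM or a multitape Turing machine) with polynomial overhead, and conversely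
  Turing machines are simulated with polynomial overhead. Polynomial time in the number of nodes of
  the input tree is therefore the usual polynomial time.
\<close>

datatype tree = Leaf | Pair tree tree

primrec nodes :: "tree \<Rightarrow> nat" where
  "nodes Leaf = 1"
| "nodes (Pair a b) = 1 + nodes a + nodes b"

primrec left :: "tree \<Rightarrow> tree" where
  "left Leaf = Leaf"
| "left (Pair a b) = a"

primrec right :: "tree \<Rightarrow> tree" where
  "right Leaf = Leaf"
| "right (Pair a b) = b"

datatype expr =
    Arg nat
  | LeafE
  | PairE expr expr
  | LeftE expr
  | RightE expr
  | IfPair expr expr expr
  | Call nat "expr list"

text \<open>
  A program is the list of its function bodies: \<open>Call i\<close> refers to the body at position \<open>i\<close>, in which
  \<open>Arg j\<close> is the \<open>j\<close>-th argument of the call. In \<open>eval p vs e v t\<close>, expression \<open>e\<close> evaluates with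
  arguments \<open>vs\<close> to \<open>v\<close>, and \<open>t\<close> is the number of expression nodes evaluated on the way.
\<close>

type_synonym program = "expr list"

inductive eval :: "program \<Rightarrow> tree list \<Rightarrow> expr \<Rightarrow> tree \<Rightarrow> nat \<Rightarrow> bool"
  and evals :: "program \<Rightarrow> tree list \<Rightarrow> expr list \<Rightarrow> tree list \<Rightarrow> nat \<Rightarrow> bool"
  for p :: program
where
  Arg: "j < length vs \<Longrightarrow> eval p vs (Arg j) (vs ! j) 1"
| LeafE: "eval p vs LeafE Leaf 1"
| PairE: "eval p vs a u s \<Longrightarrow> eval p vs b v t \<Longrightarrow> eval p vs (PairE a b) (Pair u v) (s + t + 1)"
| LeftE: "eval p vs a u s \<Longrightarrow> eval p vs (LeftE a) (left u) (s + 1)"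
| RightE: "eval p vs a u s \<Longrightarrow> eval p vs (RightE a) (right u) (s + 1)"
| IfTrue: "eval p vs a u s \<Longrightarrow> u \<noteq> Leaf \<Longrightarrow> eval p vs b v t \<Longrightarrow>
    eval p vs (IfPair a b c) v (s + t + 1)"
| IfFalse: "eval p vs a u s \<Longrightarrow> u = Leaf \<Longrightarrow> eval p vs c v t \<Longrightarrow>
    eval p vs (IfPair a b c) v (s + t + 1)"
| Call: "i < length p \<Longrightarrow> evals p vs es us s \<Longrightarrow> eval p us (p ! i) v t \<Longrightarrow>
    eval p vs (Call i es) v (s + t + 1)"
| Empty: "evals p vs [] [] 0"
| More: "eval p vs a u s \<Longrightarrow> evals p vs es us t \<Longrightarrow> evals p vs (a # es) (u # us) (s + t)"

inductive_cases eval_cases: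
  "eval p vs (Arg j) v t" "eval p vs LeafE v t" "eval p vs (PairE a b) v t"
  "eval p vs (LeftE a) v t" "eval p vs (RightE a) v t" "eval p vs (IfPair a b c) v t"
  "eval p vs (Call i es) v t" "evals p vs [] us t" "evals p vs (a # es) us t"

lemma eval_deterministic:
  "eval p vs e v t \<Longrightarrow> (\<forall>v' t'. eval p vs e v' t' \<longrightarrow> v' = v \<and> t' = t)"
  "evals p vs es us s \<Longrightarrow> (\<forall>us' s'. evals p vs es us' s' \<longrightarrow> us' = us \<and> s' = s)"
proof (induction rule: eval_evals.inducts)
  case (PairE vs a u s b v t)
  then show ?case by (metis eval_cases(3) Suc_eq_plus1)
next
  case (LeftE vs a u s)
  then show ?case by (metis eval_cases(4) Suc_eq_plus1)
next
  case (RightE vs a u s)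
  then show ?case by (metis eval_cases(5) Suc_eq_plus1)
next
  case (IfTrue vs a u s b v t c)
  then show ?case by (metis eval_cases(6) Suc_eq_plus1)
next
  case (IfFalse vs a u s c v t b)
  then show ?case by (metis eval_cases(6) Suc_eq_plus1)
next
  case (Call i vs es us s v t)
  then show ?case by (metis eval_cases(7) Suc_eq_plus1)
next
  case (More vs a u s es us t)
  then show ?case by (metis eval_cases(9))
qed (auto elim: eval_cases)

text \<open>The function at position 0 is the main function.\<close>

definition computes :: "program \<Rightarrow> tree \<Rightarrow> tree \<Rightarrow> nat \<Rightarrow> bool" where
  "computes p x v t \<longleftrightarrow> p \<noteq> [] \<and> eval p [x] (p ! 0) v t"


section \<open>Encodings\<close>

primrec encode_list :: "tree list \<Rightarrow> tree" where
  "encode_list [] = Leaf"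
| "encode_list (x # xs) = Pair x (encode_list xs)"

definition encode_bool :: "bool \<Rightarrow> tree" where
  "encode_bool b = (if b then Pair Leaf Leaf else Leaf)"

definition encode_unary :: "nat \<Rightarrow> tree" where
  "encode_unary n = encode_list (replicate n Leaf)"

text \<open>Binary digits, least significant first, without trailing zeros.\<close>

fun binary_digits :: "nat \<Rightarrow> bool list" where
  "binary_digits n = (if n = 0 then [] else odd n # binary_digits (n div 2))"

declare binary_digits.simps [simp del]

definition encode_binary :: "nat \<Rightarrow> tree" where
  "encode_binary n = encode_list (map encode_bool (binary_digits n))"

text \<open>The adjacency matrix of the graph with respect to the ordering \<open>vs\<close> of its vertices.\<close>

definition encode_graph :: "'a list \<Rightarrow> 'a set set \<Rightarrow> tree" where
  "encode_graph vs E =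
     encode_list (map (\<lambda>u. encode_list (map (\<lambda>v. encode_bool ({u, v} \<in> E)) vs)) vs)"


section \<open>Fixed-parameter tractability\<close>

definition computable :: "(nat \<Rightarrow> nat) \<Rightarrow> bool" where
  "computable f \<longleftrightarrow> (\<exists>p. \<forall>n. \<exists>t. computes p (encode_unary n) (encode_unary (f n)) t)"

text \<open>
  The decision problem asks for \<open>yes x\<close> on instances \<open>x \<in> I\<close>, presented as \<open>enc x\<close> and parameterized
  by \<open>\<kappa>\<close>. The value of the parameter is not part of the input.
\<close>

definition fixed_parameter_tractable ::
  "'i set \<Rightarrow> ('i \<Rightarrow> tree) \<Rightarrow> ('i \<Rightarrow> bool) \<Rightarrow> ('i \<Rightarrow> nat) \<Rightarrow> bool" where
  "fixed_parameter_tractable I enc yes \<kappa> \<longleftrightarrow>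
     (\<exists>p f c. computable f \<and>
        (\<forall>x\<in>I. \<exists>t. computes p (enc x) (encode_bool (yes x)) t \<and>
                   t \<le> f (\<kappa> x) * nodes (enc x) ^ c))"


section \<open>The problem\<close>

text \<open>
  An instance is a graph with vertices \<open>vs\<close>, listed in some order, and edges \<open>E\<close>, together with the
  threshold \<open>k\<close>. Every finite graph is isomorphic to one whose vertices are natural numbers.
\<close>

type_synonym alliance_instance = "nat list \<times> nat set set \<times> nat"

definition alliance_instances :: "alliance_instance set" where
  "alliance_instances = {(vs, E, k). distinct vs \<and> simple_graph (set vs) E \<and> k \<ge> 2}"

fun encode_alliance_instance :: "alliance_instance \<Rightarrow> tree" where
  "encode_alliance_instance (vs, E, k) = Pair (encode_graph vs E) (encode_binary k)"

fun has_large_globally_minimal_defensive_alliance :: "alliance_instance \<Rightarrow> bool" where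
  "has_large_globally_minimal_defensive_alliance (vs, E, k) \<longleftrightarrow>
     (\<exists>S. globally_minimal_defensive_alliance (set vs) E S \<and> card S \<ge> k)"

fun instance_neighbourhood_diversity :: "alliance_instance \<Rightarrow> nat" where
  "instance_neighbourhood_diversity (vs, E, k) = neighbourhood_diversity (set vs) E"

end

theory Submission
  imports Defs
begin

text \<open>
  Partition the vertices into at most \<open>nd\<close> classes of twins. Whether \<open>S\<close> is a globally minimal
  defensive alliance of size at least \<open>k\<close> depends only on the numbers \<open>x\<^sub>1, \<dots>, x\<^sub>K\<close> of its members in
  the \<open>K\<close> classes, and it is a Boolean combination, of size bounded in \<open>K\<close>, of inequalities
  \<open>x(A) \<ge> d\<close> with \<open>A\<close> a set of classes. Instead of integer programming, the counts are guessed digit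
  by digit in binary, the least significant digits \<open>r\<close> first: with \<open>x = 2 y + r\<close>, the inequality
  becomes \<open>y(A) \<ge> \<lceil>(d - \<bar>A \<inter> r\<bar>) / 2\<rceil>\<close>. For all possible digits, the demands of the formulas that
  occur after a given number of steps lie in windows of width \<open>K\<close>, so that their number is bounded
  in \<open>K\<close>. After as many steps as there are vertices only \<open>y = 0\<close> is left.
\<close>

section \<open>Symbolic execution of programs\<close>

text \<open>Two points make a formula of bounded size possible. First, the alliance condition must
  be linear in the counts. In a clique of twins a member sees all of its class but itself, so its
  neighbours in \<open>S\<close> number one less than a sum of counts. Counting in the closed
  neighbourhood removes this correction, because the member itself lies in \<open>S\<close>. Second,
  minimality speaks of all proper subsets of \<open>S\<close>, hence of unboundedly many smaller
  count vectors. For a fixed support the alliance conditions only become easier as the counts grow,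
  so it is enough to test the largest candidates: one unit less in one class, with some classes
  emptied. This leaves \<open>K * 2 ^ K\<close> tests.

  The demands grow with the graph, but the number of atoms depends on \<open>K\<close> alone, so a
  single formula has size linear in the demands. The parameter enters through the number of atoms,
  of digit vectors and of distinct formulas per step; the last is why duplicates are
  removed.\<close>

text \<open>
  Symbolic execution: \<open>wp p vs e Q\<close> says that \<open>e\<close> terminates with a value and a cost related by \<open>Q\<close>.
  The equations below let the simplifier run straight-line code; they stop at function calls
  (\<open>wpc\<close>), which are replaced by specifications \<open>runs p i us v T\<close>.
\<close>

definition wp where "wp p vs e Q \<longleftrightarrow> (\<exists>v t. eval p vs e v t \<and> Q v t)"
definition wps where "wps p vs es Q \<longleftrightarrow> (\<exists>us t. evals p vs es us t \<and> Q us t)"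
definition wpc where "wpc p i us Q \<longleftrightarrow> wp p us (p ! i) Q"

lemmas eval_intros = eval_evals.intros[simplified]

lemma wp_simps [simp]:
  "j < length vs \<Longrightarrow> wp p vs (Arg j) Q = Q (vs ! j) 1"
  "wp p vs LeafE Q = Q Leaf 1"
  "wp p vs (PairE a b) Q = wp p vs a (\<lambda>u s. wp p vs b (\<lambda>v t. Q (Pair u v) (s + t + 1)))"
  "wp p vs (LeftE a) Q = wp p vs a (\<lambda>u s. Q (left u) (s + 1))"
  "wp p vs (RightE a) Q = wp p vs a (\<lambda>u s. Q (right u) (s + 1))"
  "wp p vs (IfPair a b c) Q = wp p vs a (\<lambda>u s. if u = Leaf
     then wp p vs c (\<lambda>v t. Q v (s + t + 1)) else wp p vs b (\<lambda>v t. Q v (s + t + 1)))"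
  "i < length p \<Longrightarrow> wp p vs (Call i es) Q = wps p vs es (\<lambda>us s. wpc p i us (\<lambda>v t. Q v (s + t + 1)))"
  "wps p vs [] R = R [] 0"
  "wps p vs (a # es) R = wp p vs a (\<lambda>u s. wps p vs es (\<lambda>us t. R (u # us) (s + t)))"
  unfolding wp_def wps_def wpc_def
  subgoal by (auto elim!: eval_cases intro: eval_intros)
  subgoal by (auto elim!: eval_cases intro: eval_intros)
  subgoal by (fastforce elim!: eval_cases intro: eval_intros)
  subgoal by (fastforce elim!: eval_cases intro: eval_intros)
  subgoal by (fastforce elim!: eval_cases intro: eval_intros)
  subgoal
    apply (rule iffI)
     apply (elim exE conjE eval_cases(6); fastforce)
    apply (clarsimp split: if_splits)
     apply (auto intro: eval_intros)
    done
  subgoal by (fastforce elim!: eval_cases intro: eval_intros)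
  subgoal by (auto elim!: eval_cases intro: eval_intros)
  subgoal by (fastforce elim!: eval_cases intro: eval_intros)
  done

definition runs :: "program \<Rightarrow> nat \<Rightarrow> tree list \<Rightarrow> tree \<Rightarrow> nat \<Rightarrow> bool" where
  "runs p i us v T \<longleftrightarrow> (\<exists>t\<le>T. eval p us (p ! i) v t)"

lemma runsI: "wp p us (p ! i) (\<lambda>v' t. v' = v \<and> t \<le> T) \<Longrightarrow> runs p i us v T"
  by (auto simp: runs_def wp_def)

lemma runs_mono: "runs p i us v T \<Longrightarrow> T \<le> T' \<Longrightarrow> runs p i us v T'"
  unfolding runs_def by (meson le_trans)

lemma wpc_runs: "runs p i us v T \<Longrightarrow> (\<And>t. t \<le> T \<Longrightarrow> Q v t) \<Longrightarrow> wpc p i us Q"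
  by (auto simp: runs_def wpc_def wp_def)

section \<open>The program\<close>

abbreviation "a0 \<equiv> Arg 0"
abbreviation "a1 \<equiv> Arg 1"
abbreviation "a2 \<equiv> Arg 2"
abbreviation "a3 \<equiv> Arg 3"
abbreviation "TrueE \<equiv> PairE LeafE LeafE"

abbreviation "EqC a b \<equiv> Call 1 [a, b]"
abbreviation "CountC a b \<equiv> Call 2 [a, b]"
abbreviation "SetC a b \<equiv> Call 3 [a, b]"
abbreviation "CloseC a b \<equiv> Call 4 [a, b]"
abbreviation "HalfC a \<equiv> Call 5 [a]"
abbreviation "KeysC a b c \<equiv> Call 6 [a, b, c]"
abbreviation "CompressC a b \<equiv> Call 7 [a, b]"
abbreviation "EqsC a b \<equiv> Call 8 [a, b]"
abbreviation "ClassesC a b c \<equiv> Call 9 [a, b, c]"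
abbreviation "ExtendC a \<equiv> Call 10 [a]"
abbreviation "MasksC a \<equiv> Call 11 [a]"
abbreviation "InterC a b \<equiv> Call 12 [a, b]"
abbreviation "AddC a b c \<equiv> Call 13 [a, b, c]"
abbreviation "SubC a b c \<equiv> Call 14 [a, b, c]"
abbreviation "AtomC a b c d \<equiv> Call 15 [a, b, c, d]"
abbreviation "AllianceC a b c \<equiv> Call 16 [a, b, c]"
abbreviation "NoSmallerC a b c \<equiv> Call 17 [a, b, c]"
abbreviation "BoundsC a b c \<equiv> Call 18 [a, b, c]"
abbreviation "DerivC a b \<equiv> Call 19 [a, b]"
abbreviation "InsertC a b \<equiv> Call 20 [a, b]"
abbreviation "DerivsC a b c \<equiv> Call 21 [a, b, c]"
abbreviation "StepC a b \<equiv> Call 22 [a, b]"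
abbreviation "IterateC a b c \<equiv> Call 23 [a, b, c]"
abbreviation "HoldsC a \<equiv> Call 24 [a]"
abbreviation "AnyC a \<equiv> Call 25 [a]"
abbreviation "CapC a b \<equiv> Call 26 [a, b]"
abbreviation "AppendC a b \<equiv> Call 27 [a, b]"
abbreviation "DoubleC a \<equiv> Call 28 [a]"
abbreviation "ValueC a b \<equiv> Call 29 [a, b]"
abbreviation "SolveC a b c \<equiv> Call 30 [a, b, c]"
abbreviation "DecideC a b c d \<equiv> Call 31 [a, b, c, d]"

abbreviation "TopE \<equiv> PairE LeafE (PairE LeafE LeafE)"
abbreviation "AndE a b \<equiv> PairE (PairE a b) TopE"
abbreviation "NotE a \<equiv> PairE a TopE"
abbreviation "AtomE A d \<equiv> PairE LeafE (PairE A d)"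

text \<open>
  There is no \<open>let\<close>: a shared intermediate value is bound by passing it to an auxiliary function,
  which is the reason for \<open>SolveC\<close> and \<open>DecideC\<close>.
\<close>

definition "main_body = SolveC (LeftE a0)
  (KeysC (LeftE a0) (CloseC (LeftE a0) LeafE) (CloseC (LeftE a0) LeafE)) (RightE a0)"
definition "eq_body = IfPair a0
  (IfPair a1 (IfPair (EqC (LeftE a0) (LeftE a1)) (EqC (RightE a0) (RightE a1)) LeafE) LeafE)
  (IfPair a1 LeafE TrueE)"
definition "count_body = IfPair a1
  (IfPair (EqC a0 (LeftE a1)) (PairE LeafE (CountC a0 (RightE a1))) (CountC a0 (RightE a1))) LeafE"
definition "set_body = IfPair a1
  (PairE (LeftE a0) (SetC (RightE a0) (RightE a1))) (PairE TrueE (RightE a0))"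
definition "close_body = IfPair a0
  (PairE (SetC (LeftE a0) a1) (CloseC (RightE a0) (PairE LeafE a1))) LeafE"
definition "half_body = IfPair a0 (PairE LeafE (HalfC (RightE (RightE a0)))) LeafE"
text \<open>\<open>RightE\<close> subtracts one from a unary number. Applied to the count of equal
  closed rows it yields a pair exactly if the count is at least two.\<close>

definition "keys_body = IfPair a0
  (PairE
    (IfPair (RightE (CountC (LeftE a1) a2))
      (PairE (LeftE a1) (HalfC (CountC TrueE (LeftE a1))))
      (PairE (LeftE a0) (HalfC (RightE (CountC TrueE (LeftE a0))))))
    (KeysC (RightE a0) (RightE a1) a2)) LeafE"
definition "compress_body = IfPair a1
  (IfPair (CountC (LeftE a1) (RightE a1)) (CompressC (RightE a0) (RightE a1))
    (PairE (LeftE a0) (CompressC (RightE a0) (RightE a1)))) LeafE"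
definition "eqs_body = IfPair a1 (PairE (EqC a0 (LeftE a1)) (EqsC a0 (RightE a1))) LeafE"
definition "classes_body = IfPair a0
  (PairE
    (PairE (EqsC (LeftE a0) a1)
      (PairE (CompressC (LeftE (LeftE a0)) a2) (PairE (RightE (LeftE a0)) (CountC (LeftE a0) a2))))
    (ClassesC (RightE a0) a1 a2)) LeafE"
definition "extend_body = IfPair a0
  (PairE (PairE TrueE (LeftE a0)) (PairE (PairE LeafE (LeftE a0)) (ExtendC (RightE a0)))) LeafE"
definition "masks_body = IfPair a0 (ExtendC (MasksC (RightE a0))) (PairE LeafE LeafE)"
definition "inter_body = IfPair a0
  (PairE (IfPair (LeftE a0) (LeftE a1) LeafE) (InterC (RightE a0) (RightE a1))) LeafE"
definition "add_body = IfPair a1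
  (IfPair (LeftE a1)
    (IfPair (LeftE a2) (PairE LeafE (AddC a0 (RightE a1) (RightE a2))) (AddC a0 (RightE a1) (RightE a2)))
    (AddC a0 (RightE a1) (RightE a2))) a0"
definition "sub_body = IfPair a1
  (IfPair (LeftE a1)
    (IfPair (LeftE a2) (SubC (RightE a0) (RightE a1) (RightE a2)) (SubC a0 (RightE a1) (RightE a2)))
    (SubC a0 (RightE a1) (RightE a2))) a0"
definition "atom_body = AtomE (InterC a2 a0) (AddC a3 (InterC a2 a0) a1)"
definition "alliance_body = IfPair a2
  (AndE
    (PairE (AtomC a0 a1 (LeftE (LeftE a2)) TrueE)
      (NotE (AtomC a0 a1 (LeftE (RightE (LeftE a2))) (LeftE (RightE (RightE (LeftE a2)))))))
    (AllianceC a0 a1 (RightE a2)))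
  (AtomE a0 (AddC TrueE a0 a1))"
definition "no_smaller_body = IfPair a1
  (AndE (PairE (AtomE a0 TrueE) (AllianceC (LeftE a1) a0 a2)) (NoSmallerC a0 (RightE a1) a2)) TopE"
definition "bounds_body = IfPair a2
  (AndE (NotE (AtomE (LeftE (LeftE a2)) (PairE LeafE (RightE (RightE (RightE (LeftE a2)))))))
    (AndE (NoSmallerC (LeftE (LeftE a2)) a0 a1) (BoundsC a0 a1 (RightE a2)))) TopE"
definition "deriv_body = IfPair (LeftE a0)
  (PairE (DerivC (LeftE a0) a1) (DerivC (RightE a0) a1))
  (AtomE (LeftE (RightE a0)) (HalfC (SubC (RightE (RightE a0)) (LeftE (RightE a0)) a1)))"
definition "insert_body = IfPair (CountC a0 a1) a1 (PairE a0 a1)"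
definition "derivs_body = IfPair a1 (InsertC (DerivC a0 (LeftE a1)) (DerivsC a0 (RightE a1) a2)) a2"
definition "step_body = IfPair a0 (DerivsC (LeftE a0) a1 (StepC (RightE a0) a1)) LeafE"
definition "iterate_body = IfPair a0 (IterateC (RightE a0) (StepC a1 a2) a2) a1"
definition "holds_body = IfPair (LeftE a0)
  (IfPair (HoldsC (LeftE a0)) (IfPair (HoldsC (RightE a0)) LeafE TrueE) TrueE)
  (IfPair (RightE (RightE a0)) LeafE TrueE)"
definition "any_body = IfPair a0 (IfPair (HoldsC (LeftE a0)) TrueE (AnyC (RightE a0))) LeafE"
definition "cap_body = IfPair a0
  (IfPair a1 (PairE LeafE (CapC (RightE a0) (RightE a1))) LeafE) LeafE"
definition "append_body = IfPair a0 (PairE (LeftE a0) (AppendC (RightE a0) a1)) a1"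
definition "double_body = AppendC a0 a0"
definition "value_body = IfPair a0
  (CapC (IfPair (LeftE a0) (PairE LeafE (DoubleC (ValueC (RightE a0) a1)))
    (DoubleC (ValueC (RightE a0) a1))) a1) LeafE"
definition "solve_body = DecideC a0 (ClassesC (CompressC a1 a1) (CompressC a1 a1) a1)
  (MasksC (CompressC a1 a1)) (ValueC a2 (PairE LeafE a0))"
definition "decide_body = AnyC (IterateC a0
  (PairE (AndE (AllianceC (LeftE a2) LeafE a1) (AndE (AtomE (LeftE a2) a3) (BoundsC a2 a1 a1))) LeafE)
  a2)"

definition alliance_program :: program where
  "alliance_program = [main_body, eq_body, count_body, set_body, close_body, half_body, keys_body,
    compress_body, eqs_body, classes_body, extend_body, masks_body, inter_body, add_body, sub_body,
    atom_body, alliance_body, no_smaller_body, bounds_body, deriv_body, insert_body, derivs_body,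
    step_body, iterate_body, holds_body, any_body, cap_body, append_body, double_body, value_body,
    solve_body, decide_body]"

lemma length_program [simp]: "length alliance_program = 32"
  by (simp add: alliance_program_def)

lemma program_nth [simp]:
  "alliance_program ! 0 = main_body"
  "alliance_program ! 1 = eq_body"
  "alliance_program ! Suc 0 = eq_body"
  "alliance_program ! 2 = count_body"
  "alliance_program ! 3 = set_body"
  "alliance_program ! 4 = close_body"
  "alliance_program ! 5 = half_body"
  "alliance_program ! 6 = keys_body"
  "alliance_program ! 7 = compress_body"
  "alliance_program ! 8 = eqs_body"
  "alliance_program ! 9 = classes_body"
  "alliance_program ! 10 = extend_body"
  "alliance_program ! 11 = masks_body"
  "alliance_program ! 12 = inter_body"
  "alliance_program ! 13 = add_body"
  "alliance_program ! 14 = sub_body"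
  "alliance_program ! 15 = atom_body"
  "alliance_program ! 16 = alliance_body"
  "alliance_program ! 17 = no_smaller_body"
  "alliance_program ! 18 = bounds_body"
  "alliance_program ! 19 = deriv_body"
  "alliance_program ! 20 = insert_body"
  "alliance_program ! 21 = derivs_body"
  "alliance_program ! 22 = step_body"
  "alliance_program ! 23 = iterate_body"
  "alliance_program ! 24 = holds_body"
  "alliance_program ! 25 = any_body"
  "alliance_program ! 26 = cap_body"
  "alliance_program ! 27 = append_body"
  "alliance_program ! 28 = double_body"
  "alliance_program ! 29 = value_body"
  "alliance_program ! 30 = solve_body"
  "alliance_program ! 31 = decide_body"
  by (simp_all add: alliance_program_def)

abbreviation "prun \<equiv> runs alliance_program"

abbreviation "encode_mask A \<equiv> encode_list (map encode_bool A)"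

lemma encode_bool_simps [simp]:
  "encode_bool True = Pair Leaf Leaf" "encode_bool False = Leaf" "encode_bool b = Leaf \<longleftrightarrow> \<not> b"
  by (simp_all add: encode_bool_def)

lemma encode_unary_simps [simp]:
  "encode_unary 0 = Leaf" "encode_unary (Suc n) = Pair Leaf (encode_unary n)"
  "encode_unary n = Leaf \<longleftrightarrow> n = 0"
  by (cases n; simp add: encode_unary_def)+

lemma nodes_pos: "0 < nodes t"
  by (cases t) auto

lemma nodes_encode_unary [simp]: "nodes (encode_unary n) = 2 * n + 1"
  by (induction n) auto

lemma encode_list_eq_Leaf [simp]: "encode_list xs = Leaf \<longleftrightarrow> xs = []"
  by (cases xs) auto

lemma right_encode_unary [simp]: "right (encode_unary n) = encode_unary (n - 1)"
  by (cases n) auto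

text \<open>The recursion stops as soon as one argument is a leaf, so the second argument alone
  bounds the cost. A search for any tree in a list therefore costs at most linear time in the
  list.\<close>

lemma run_eq: "prun (Suc 0) [a, b] (encode_bool (a = b)) (20 * nodes b)"
proof (induction b arbitrary: a)
  case Leaf
  show ?case by (rule runsI) (simp add: eq_body_def)
next
  case (Pair b1 b2)
  show ?case
  proof (cases a)
    case Leaf
    then show ?thesis by (intro runsI) (simp add: eq_body_def)
  next
    case (Pair x y)
    then show ?thesis
      by (intro runsI) (auto simp: eq_body_def intro!: Pair.IH[THEN wpc_runs])
  qed
qed

lemma run_count:
  "prun 2 [x, encode_list xs] (encode_unary (count_list xs x)) (40 * nodes (encode_list xs))"
proof (induction xs)
  case Nil
  show ?case by (rule runsI) (simp add: count_body_def)
next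
  case (Cons y ys)
  then show ?case
    by (intro runsI) (auto simp: count_body_def intro!: run_eq[THEN wpc_runs] Cons.IH[THEN wpc_runs])
qed

lemma run_set:
  "i < length row \<Longrightarrow>
    prun 3 [encode_mask row, encode_unary i] (encode_mask (row[i := True])) (20 * (i + 1))"
proof (induction i arbitrary: row)
  case 0
  then show ?case by (cases row) (auto intro!: runsI simp: set_body_def)
next
  case (Suc i)
  then show ?case
    by (cases row) (auto intro!: runsI Suc.IH[THEN wpc_runs] simp: set_body_def)
qed

fun close :: "nat \<Rightarrow> bool list list \<Rightarrow> bool list list" where
  "close i [] = []"
| "close i (row # rows) = row[i := True] # close (Suc i) rows"

lemma run_close:
  "\<forall>row\<in>set rows. i + length rows \<le> length row \<Longrightarrow>
    prun 4 [encode_list (map encode_mask rows), encode_unary i]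
      (encode_list (map encode_mask (close i rows))) (length rows * (20 * (i + length rows) + 50) + 10)"
proof (induction rows arbitrary: i)
  case Nil
  show ?case by (rule runsI) (simp add: close_body_def)
next
  case (Cons row rows)
  have "i < length row" using Cons.prems by auto
  with Cons show ?case
    by (intro runsI) (auto simp: close_body_def algebra_simps
      intro!: run_set[THEN wpc_runs] Cons.IH[of "Suc i", THEN wpc_runs, simplified])
qed

section \<open>Vertex keys\<close>

definition half :: "nat \<Rightarrow> nat" where "half n = (n + 1) div 2"

lemma half_simps [simp]: "half 0 = 0" "half (Suc 0) = Suc 0" "half (Suc (Suc n)) = Suc (half n)"
  by (simp_all add: half_def)

lemma run_half: "prun 5 [encode_unary n] (encode_unary (half n)) (20 * (n + 1))"
proof (induction n rule: less_induct)
  case (less n)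
  show ?case
  proof (cases n)
    case 0
    then show ?thesis by (auto intro!: runsI simp: half_body_def)
  next
    case (Suc m)
    have "half (Suc m) = Suc (half (m - Suc 0))" by (cases m) auto
    with Suc less show ?thesis
      by (auto intro!: runsI less[of "m - Suc 0", THEN wpc_runs] simp: half_body_def)
  qed
qed

text \<open>
  The closed row of a vertex is used if some other vertex has the same closed row, the open row
  otherwise; twins then have equal keys. The second component is the number of members of an
  alliance that a member of it needs in the chosen neighbourhood.
\<close>

definition key :: "bool list list \<Rightarrow> bool list \<Rightarrow> bool list \<Rightarrow> bool list \<times> nat" where
  "key all row crow = (if 2 \<le> count_list all crow then (crow, half (count_list crow True))
     else (row, half (count_list row True - 1)))"

definition encode_key :: "bool list \<times> nat \<Rightarrow> tree" where
  "encode_key \<kappa> = Pair (encode_mask (fst \<kappa>)) (encode_unary (snd \<kappa>))"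

lemma inj_encode_bool: "inj encode_bool"
  by (auto simp: inj_def encode_bool_def split: if_splits)

lemma inj_encode_list: "inj encode_list"
proof
  show "xs = ys" if "encode_list xs = encode_list ys" for xs ys
    using that
  proof (induction xs arbitrary: ys)
    case (Cons x xs)
    then show ?case by (cases ys) auto
  qed (metis encode_list.simps(1) encode_list_eq_Leaf)
qed

lemma inj_encode_mask: "inj (\<lambda>A. encode_mask A)"
  using inj_compose[OF inj_encode_list inj_mapI[OF inj_encode_bool]] by (simp add: o_def)

lemma inj_encode_unary: "inj encode_unary"
  by (rule injI, drule arg_cong[of _ _ nodes]) simp

lemma inj_encode_key: "inj encode_key"
  by (auto simp: inj_def encode_key_def prod_eq_iff dest: injD[OF inj_encode_mask] injD[OF inj_encode_unary])

lemma count_list_inj: "inj f \<Longrightarrow> count_list (map f xs) (f x) = count_list xs x"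
  by (induction xs) (auto dest: injD)

lemma run_count_mask:
  "prun 2 [encode_mask A, encode_list (map encode_mask As)] (encode_unary (count_list As A))
    (40 * nodes (encode_list (map encode_mask As)))"
  using run_count[of "encode_mask A" "map encode_mask As"] count_list_inj[OF inj_encode_mask] by simp

lemma run_count_bool:
  "prun 2 [Pair Leaf Leaf, encode_mask A] (encode_unary (count_list A True)) (40 * nodes (encode_mask A))"
  using run_count[of "encode_bool True" "map encode_bool A"]
  unfolding count_list_inj[OF inj_encode_bool] by simp

lemma length_le_nodes: "length xs \<le> nodes (encode_list xs)"
  by (induction xs) auto

lemma run_keys:
  assumes "length rows = length crows" "\<forall>r\<in>set rows \<union> set crows. nodes (encode_mask r) \<le> B"
  shows "prun 6 [encode_list (map encode_mask rows), encode_list (map encode_mask crows),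
      encode_list (map encode_mask all)]
    (encode_list (map encode_key (map2 (key all) rows crows)))
    (length rows * (40 * nodes (encode_list (map encode_mask all)) + 60 * B + 100) + 10)"
  using assms
proof (induction rows crows rule: list_induct2)
  case Nil
  show ?case by (rule runsI) (simp add: keys_body_def)
next
  case (Cons r rs c cs)
  have "count_list c True \<le> B" "count_list r True - 1 \<le> B" 
    using count_le_length[of c True] count_le_length[of r True] Cons.prems
      length_le_nodes[of "map encode_bool c"] length_le_nodes[of "map encode_bool r"] by auto
  with Cons show ?case
    by (intro runsI) (auto simp: keys_body_def key_def encode_key_def algebra_simps
      intro!: run_count_mask[THEN wpc_runs] run_count_bool[THEN wpc_runs]
        run_half[THEN wpc_runs] Cons.IH[THEN wpc_runs])
qed

text \<open>Keeps the entries at the last occurrence of each key.\<close>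

fun compress :: "'a list \<Rightarrow> 'b list \<Rightarrow> 'a list" where
  "compress (x # xs) (k # ks) = (if k \<in> set ks then compress xs ks else x # compress xs ks)"
| "compress _ _ = []"

lemma run_compress:
  "length xs = length ks \<Longrightarrow> prun 7 [encode_list xs, encode_list ks] (encode_list (compress xs ks))
    (length ks * (40 * nodes (encode_list ks) + 50) + 10)"
proof (induction xs ks rule: list_induct2)
  case Nil
  show ?case by (rule runsI) (simp add: compress_body_def)
next
  case (Cons x xs k ks)
  have "length ks * (40 * nodes (encode_list ks) + 50) \<le> length ks * (40 * nodes (encode_list (k # ks)) + 50)"
    by simp
  with Cons show ?case
    by (intro runsI) (auto simp: compress_body_def count_list_0_iff algebra_simps
      intro!: run_count[THEN wpc_runs] Cons.IH[THEN wpc_runs])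
qed

section \<open>Descriptions of classes\<close>

type_synonym vertex_key = "bool list \<times> nat"
text \<open>
  Masks select classes by their position. A class is described by its unit mask, the mask of the
  classes in its chosen neighbourhood, its demand in that neighbourhood and its size.
\<close>

type_synonym vertex_class = "bool list \<times> bool list \<times> nat \<times> nat"

fun encode_class :: "vertex_class \<Rightarrow> tree" where
  "encode_class (e, A, t, n) =
     Pair (encode_mask e) (Pair (encode_mask A) (Pair (encode_unary t) (encode_unary n)))"

text \<open>A key has one bit per vertex. Compressing it along \<open>keys\<close> keeps the columns
  at which \<open>compress\<close> also picks the representatives, which leaves one bit per class in
  matching order.\<close>

definition classes :: "vertex_key list \<Rightarrow> vertex_key list \<Rightarrow> vertex_key list \<Rightarrow> vertex_class list" where
  "classes ds all keys =
     map (\<lambda>\<kappa>. (map ((=) \<kappa>) all, compress (fst \<kappa>) keys, snd \<kappa>, count_list keys \<kappa>)) ds"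

lemma compress_map: "inj g \<Longrightarrow> compress (map f xs) (map g ks) = map f (compress xs ks)"
  by (induction xs ks rule: compress.induct) (auto dest: injD)

lemma run_compress_mask:
  "length A = length keys \<Longrightarrow> prun 7 [encode_mask A, encode_list (map encode_key keys)]
    (encode_mask (compress A keys))
    (length keys * (40 * nodes (encode_list (map encode_key keys)) + 50) + 10)"
  using run_compress[of "map encode_bool A" "map encode_key keys"]
  by (simp add: compress_map[OF inj_encode_key])

lemma run_compress_keys:
  "prun 7 [encode_list (map encode_key keys), encode_list (map encode_key keys)]
    (encode_list (map encode_key (compress keys keys)))
    (length keys * (40 * nodes (encode_list (map encode_key keys)) + 50) + 10)"
  using run_compress[of "map encode_key keys" "map encode_key keys"]
  by (simp add: compress_map[OF inj_encode_key])

lemma run_count_key: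
  "prun 2 [encode_key \<kappa>, encode_list (map encode_key keys)] (encode_unary (count_list keys \<kappa>))
    (40 * nodes (encode_list (map encode_key keys)))"
  using run_count[of "encode_key \<kappa>" "map encode_key keys"] count_list_inj[OF inj_encode_key] by simp

lemma encode_key_eq [simp]: "encode_key \<kappa> = encode_key \<kappa>' \<longleftrightarrow> \<kappa> = \<kappa>'"
  using inj_encode_key by (auto dest: injD)

lemma run_eqs:
  "prun 8 [encode_key \<kappa>, encode_list (map encode_key ds)] (encode_mask (map ((=) \<kappa>) ds))
    (40 * nodes (encode_list (map encode_key ds)))"
proof (induction ds)
  case Nil
  show ?case by (rule runsI) (simp add: eqs_body_def)
next
  case (Cons d ds)
  then show ?case
    by (intro runsI) (auto simp: eqs_body_def intro!: run_eq[THEN wpc_runs] Cons.IH[THEN wpc_runs])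
qed

lemma left_right_key [simp]:
  "left (encode_key \<kappa>) = encode_mask (fst \<kappa>)" "right (encode_key \<kappa>) = encode_unary (snd \<kappa>)"
  by (simp_all add: encode_key_def)

lemma run_classes:
  "\<forall>\<kappa>\<in>set ds. length (fst \<kappa>) = length keys \<Longrightarrow>
    prun 9 [encode_list (map encode_key ds), encode_list (map encode_key all),
        encode_list (map encode_key keys)]
      (encode_list (map encode_class (classes ds all keys)))
      (length ds * (40 * nodes (encode_list (map encode_key all))
        + length keys * (40 * nodes (encode_list (map encode_key keys)) + 50)
        + 40 * nodes (encode_list (map encode_key keys)) + 100) + 10)"
proof (induction ds)
  case Nil
  show ?case by (rule runsI) (simp add: classes_body_def classes_def)
next
  case (Cons d ds)
  then show ?case
    by (intro runsI) (auto simp: classes_body_def classes_def algebra_simps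
      intro!: run_eqs[THEN wpc_runs] run_compress_mask[THEN wpc_runs] run_count_key[THEN wpc_runs]
        Cons.IH[THEN wpc_runs])
qed

section \<open>Masks of classes\<close>

fun extend :: "bool list list \<Rightarrow> bool list list" where
  "extend [] = []"
| "extend (x # xs) = (True # x) # (False # x) # extend xs"

text \<open>The masks serve both as digit vectors and as sets of classes to which a smaller vector
  is restricted. Since \<open>extend\<close> puts \<open>True\<close> first, the head is the mask of
  all classes.\<close>

primrec masks :: "nat \<Rightarrow> bool list list" where
  "masks 0 = [[]]"
| "masks (Suc k) = extend (masks k)"

lemma length_extend [simp]: "length (extend xs) = 2 * length xs"
  by (induction xs) auto

lemma length_masks [simp]: "length (masks k) = 2 ^ k"
  by (induction k) auto

lemma run_extend:
  "prun 10 [encode_list (map encode_mask xs)] (encode_list (map encode_mask (extend xs)))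
    (50 * (length xs + 1))"
proof (induction xs)
  case Nil
  show ?case by (rule runsI) (simp add: extend_body_def)
next
  case (Cons x xs)
  then show ?case
    by (intro runsI) (auto simp: extend_body_def intro!: Cons.IH[THEN wpc_runs])
qed

lemma run_masks:
  "prun 11 [encode_list ds] (encode_list (map encode_mask (masks (length ds)))) (200 * 2 ^ length ds)"
proof (induction ds)
  case Nil
  show ?case by (rule runsI) (simp add: masks_body_def)
next
  case (Cons d ds)
  have "56 + 50 * 2 ^ length ds \<le> (200::nat) * 2 ^ length ds"
    using one_le_power[of "2::nat" "length ds"] by linarith
  with Cons show ?case
    by (intro runsI) (auto simp: masks_body_def intro!: Cons.IH[THEN wpc_runs] run_extend[THEN wpc_runs])
qed

section \<open>Atoms and the formula of an instance\<close>

fun overlap :: "bool list \<Rightarrow> bool list \<Rightarrow> nat" where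
  "overlap (a # A) (b # r) = (if a \<and> b then 1 else 0) + overlap A r"
| "overlap _ _ = 0"

abbreviation inter :: "bool list \<Rightarrow> bool list \<Rightarrow> bool list" where
  "inter \<equiv> map2 (\<and>)"

lemma run_inter:
  "length A = length R \<Longrightarrow>
    prun 12 [encode_mask A, encode_mask R] (encode_mask (inter A R)) (30 * (length A + 1))"
proof (induction A R rule: list_induct2)
  case Nil
  show ?case by (rule runsI) (simp add: inter_body_def)
next
  case (Cons a A r R)
  then show ?case
    by (cases a) (auto simp: inter_body_def intro!: runsI Cons.IH[THEN wpc_runs])
qed

lemma run_add:
  "prun 13 [encode_unary d, encode_mask A, encode_mask e] (encode_unary (d + overlap A e))
    (30 * (length A + 1))"
proof (induction A arbitrary: e)
  case Nil
  show ?case by (rule runsI) (simp add: add_body_def)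
next
  case (Cons a A)
  \<comment> \<open>\<open>left\<close> and \<open>right\<close> of \<open>Leaf\<close> are
    \<open>Leaf\<close>, so an exhausted \<open>e\<close> acts as if padded with zeros. In
    particular \<open>[]\<close> can stand for the zero vector.\<close>
  note IH = Cons.IH[of "[]", THEN wpc_runs, simplified] Cons.IH[THEN wpc_runs]
  show ?case
    by (cases e; cases a) (auto simp: add_body_def intro!: runsI IH)
qed

lemma run_sub:
  "prun 14 [encode_unary d, encode_mask A, encode_mask r] (encode_unary (d - overlap A r))
    (30 * (length A + 1))"
proof (induction A arbitrary: d r)
  case Nil
  show ?case by (rule runsI) (simp add: sub_body_def)
next
  case (Cons a A)
  note IH = Cons.IH[of _ "[]", THEN wpc_runs, simplified] Cons.IH[THEN wpc_runs]
  show ?case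
    by (cases r; cases a) (auto simp: sub_body_def intro!: runsI IH)
qed

text \<open>
  \<open>Atom A d\<close> says that the counts of the classes in \<open>A\<close> sum up to at least \<open>d\<close>. Formulas are never
  encoded by \<open>Leaf\<close>, so that the first component tells atoms from other formulas.
\<close>

datatype fm = Atom "bool list" nat | Nand fm fm

primrec encode_fm :: "fm \<Rightarrow> tree" where
  "encode_fm (Atom A d) = Pair Leaf (Pair (encode_mask A) (encode_unary d))"
| "encode_fm (Nand \<phi> \<psi>) = Pair (encode_fm \<phi>) (encode_fm \<psi>)"

abbreviation "Top \<equiv> Atom [] 0"
abbreviation "And \<phi> \<psi> \<equiv> Nand (Nand \<phi> \<psi>) Top"
abbreviation "Neg \<phi> \<equiv> Nand \<phi> Top"

lemma encode_fm_not_Leaf [simp]: "encode_fm \<phi> \<noteq> Leaf"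
  by (cases \<phi>) auto

lemma encode_fm_eq [simp]: "encode_fm \<phi> = encode_fm \<psi> \<longleftrightarrow> \<phi> = \<psi>"
proof (induction \<phi> arbitrary: \<psi>)
  case (Atom A d)
  then show ?case
    using inj_encode_mask inj_encode_unary by (cases \<psi>) (auto dest: injD simp: encode_fm_not_Leaf[symmetric])
next
  case (Nand \<phi>1 \<phi>2)
  then show ?case by (cases \<psi>) auto
qed

text \<open>
  The atom \<open>Atom A d\<close> for the counts \<open>x - e\<close>, restricted to the classes in \<open>R\<close>, as an atom for \<open>x\<close>
  (correct only if \<open>x \<ge> e\<close>).
\<close>

definition restricted_atom :: "bool list \<Rightarrow> bool list \<Rightarrow> bool list \<Rightarrow> nat \<Rightarrow> fm" where
  "restricted_atom R e A d = Atom (inter A R) (d + overlap (inter A R) e)"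

lemma run_atom:
  "length A = K \<Longrightarrow> length R = K \<Longrightarrow>
    prun 15 [encode_mask R, encode_mask e, encode_mask A, encode_unary d]
      (encode_fm (restricted_atom R e A d)) (120 * (K + 1))"
  by (rule runsI) (auto simp: atom_body_def restricted_atom_def
      intro!: run_inter[THEN wpc_runs] run_add[THEN wpc_runs])

text \<open>The \<open>Nand\<close> with a negated second part is an implication: a class that is
  met must have its demand fulfilled. The base case expresses that the restricted vector is
  non-zero.\<close>

fun alliance_fm :: "bool list \<Rightarrow> bool list \<Rightarrow> vertex_class list \<Rightarrow> fm" where
  "alliance_fm R e [] = Atom R (1 + overlap R e)"
| "alliance_fm R e ((u, A, t, n) # cs) =
     And (Nand (restricted_atom R e u 1) (Neg (restricted_atom R e A t))) (alliance_fm R e cs)"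

definition class_masks :: "nat \<Rightarrow> vertex_class list \<Rightarrow> bool" where
  "class_masks K cs \<longleftrightarrow> (\<forall>(u, A, t, n)\<in>set cs. length u = K \<and> length A = K)"

lemma run_alliance:
  "class_masks K cs \<Longrightarrow> length R = K \<Longrightarrow>
    prun 16 [encode_mask R, encode_mask e, encode_list (map encode_class cs)]
      (encode_fm (alliance_fm R e cs)) (300 * (K + 1) * (length cs + 1))"
proof (induction R e cs rule: alliance_fm.induct)
  case (1 R e)
  then show ?case
    by (intro runsI) (auto simp: alliance_body_def intro!: run_add[of "Suc 0", THEN wpc_runs, simplified])
next
  case (2 R e u A t n cs)
  then have *: "length u = K" "length A = K" "class_masks K cs" by (auto simp: class_masks_def)
  with 2 show ?case
    by (intro runsI) (auto simp: alliance_body_def algebra_simps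
      intro!: run_atom[of u K R e 1, THEN wpc_runs, simplified] run_atom[THEN wpc_runs] "2.IH"[THEN wpc_runs])
qed

text \<open>The conjunct \<open>Atom u 1\<close> guards the translation of conditions on
  \<open>x - u\<close> into conditions on \<open>x\<close>, which is sound only for
  \<open>u \<le> x\<close>.\<close>

fun no_smaller_fm :: "bool list \<Rightarrow> bool list list \<Rightarrow> vertex_class list \<Rightarrow> fm" where
  "no_smaller_fm u [] cs = Top"
| "no_smaller_fm u (R # Rs) cs = And (Nand (Atom u 1) (alliance_fm R u cs)) (no_smaller_fm u Rs cs)"

lemma run_no_smaller:
  "class_masks K cs \<Longrightarrow> \<forall>R\<in>set Rs. length R = K \<Longrightarrow>
    prun 17 [encode_mask u, encode_list (map encode_mask Rs), encode_list (map encode_class cs)]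
      (encode_fm (no_smaller_fm u Rs cs)) (length Rs * (300 * (K + 1) * (length cs + 1) + 50) + 20)"
proof (induction Rs)
  case Nil
  show ?case by (rule runsI) (simp add: no_smaller_body_def)
next
  case (Cons R Rs)
  then show ?case
    by (intro runsI) (auto simp: no_smaller_body_def algebra_simps
      intro!: run_alliance[THEN wpc_runs] Cons.IH[THEN wpc_runs])
qed

fun bounds_fm :: "bool list list \<Rightarrow> vertex_class list \<Rightarrow> vertex_class list \<Rightarrow> fm" where
  "bounds_fm Rs all [] = Top"
| "bounds_fm Rs all ((u, A, t, n) # cs) =
     And (Neg (Atom u (Suc n))) (And (no_smaller_fm u Rs all) (bounds_fm Rs all cs))"

lemma run_bounds:
  "class_masks K all \<Longrightarrow> \<forall>R\<in>set Rs. length R = K \<Longrightarrow>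
    prun 18 [encode_list (map encode_mask Rs), encode_list (map encode_class all),
        encode_list (map encode_class cs)]
      (encode_fm (bounds_fm Rs all cs))
      (length cs * (length Rs * (300 * (K + 1) * (length all + 1) + 50) + 100) + 20)"
proof (induction Rs all cs rule: bounds_fm.induct)
  case (1 Rs all)
  then show ?case by (intro runsI) (simp add: bounds_body_def)
next
  case (2 Rs all u A t n cs)
  then show ?case
    by (intro runsI) (auto simp: bounds_body_def algebra_simps
      intro!: run_no_smaller[THEN wpc_runs] "2.IH"[THEN wpc_runs])
qed

text \<open>
  The solutions of the derivative are the vectors \<open>y\<close> such that \<open>2 y + r\<close> solves the formula.
\<close>

primrec deriv_fm :: "bool list \<Rightarrow> fm \<Rightarrow> fm" where
  "deriv_fm r (Atom A d) = Atom A (half (d - overlap A r))"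
| "deriv_fm r (Nand \<phi> \<psi>) = Nand (deriv_fm r \<phi>) (deriv_fm r \<psi>)"

lemma length_le_nodes_mask: "2 * length A + 1 \<le> nodes (encode_mask A)"
proof (induction A)
  case (Cons a A)
  then show ?case using nodes_pos[of "encode_bool a"] by simp
qed simp

lemma run_deriv:
  "prun 19 [encode_fm \<phi>, encode_mask r] (encode_fm (deriv_fm r \<phi>)) (50 * nodes (encode_fm \<phi>))"
proof (induction \<phi>)
  case (Atom A d)
  then show ?case
    using length_le_nodes_mask[of A]
    by (intro runsI) (auto simp: deriv_body_def intro!: run_sub[THEN wpc_runs] run_half[THEN wpc_runs])
next
  case (Nand \<phi> \<psi>)
  then show ?case
    by (intro runsI) (auto simp: deriv_body_def intro!: Nand.IH[THEN wpc_runs])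
qed

section \<open>Collecting and iterating derivatives\<close>

lemma run_insert:
  "prun 20 [encode_fm \<phi>, encode_list (map encode_fm \<phi>s)] (encode_list (map encode_fm (List.insert \<phi> \<phi>s)))
    (40 * nodes (encode_list (map encode_fm \<phi>s)) + 20)"
proof -
  have "inj encode_fm" by (auto simp: inj_def)
  then show ?thesis
    by (intro runsI) (auto simp: insert_body_def count_list_inj count_list_0_iff
      intro!: run_count[THEN wpc_runs])
qed

text \<open>Inserting without repetition makes the list as long as its set of formulas is large.
  Otherwise its length would be multiplied by the number of digit vectors in every step.\<close>

definition derivs :: "fm \<Rightarrow> bool list list \<Rightarrow> fm list \<Rightarrow> fm list" where
  "derivs \<phi> rs acc = foldr (\<lambda>r. List.insert (deriv_fm r \<phi>)) rs acc"

definition step :: "bool list list \<Rightarrow> fm list \<Rightarrow> fm list" where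
  "step rs \<phi>s = foldr (\<lambda>\<phi>. derivs \<phi> rs) \<phi>s []"

abbreviation "nodes_fms \<phi>s \<equiv> nodes (encode_list (map encode_fm \<phi>s))"

lemma nodes_insert: "nodes_fms \<phi>s \<le> nodes_fms (List.insert \<phi> \<phi>s)"
  by (simp add: List.insert_def)

text \<open>Accumulators only grow, so a size bound for the final list also bounds the cost of every
  membership test on the way.\<close>

lemma nodes_derivs: "nodes_fms acc \<le> nodes_fms (derivs \<phi> rs acc)"
  unfolding derivs_def by (induction rs) (auto intro: order_trans[OF _ nodes_insert])

lemma run_derivs:
  "nodes_fms (derivs \<phi> rs acc) \<le> B \<Longrightarrow>
    prun 21 [encode_fm \<phi>, encode_list (map encode_mask rs), encode_list (map encode_fm acc)]
      (encode_list (map encode_fm (derivs \<phi> rs acc)))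
      (length rs * (50 * nodes (encode_fm \<phi>) + 40 * B + 50) + 10)"
proof (induction rs)
  case Nil
  show ?case by (rule runsI) (simp add: derivs_body_def derivs_def)
next
  case (Cons r rs)
  have eq: "derivs \<phi> (r # rs) acc = List.insert (deriv_fm r \<phi>) (derivs \<phi> rs acc)"
    by (simp add: derivs_def)
  with Cons.prems have "nodes_fms (derivs \<phi> rs acc) \<le> B"
    using nodes_insert order_trans by metis
  with Cons.IH show ?case
    unfolding eq by (intro runsI) (auto simp: derivs_body_def algebra_simps
      intro!: run_deriv[THEN wpc_runs] run_insert[THEN wpc_runs] Cons.IH[THEN wpc_runs])
qed

lemma run_step:
  "nodes_fms (step rs \<phi>s) \<le> B \<Longrightarrow> \<forall>\<phi>\<in>set \<phi>s. nodes (encode_fm \<phi>) \<le> M \<Longrightarrow>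
    prun 22 [encode_list (map encode_fm \<phi>s), encode_list (map encode_mask rs)]
      (encode_list (map encode_fm (step rs \<phi>s)))
      (length \<phi>s * (length rs * (50 * M + 40 * B + 50) + 50) + 10)"
proof (induction \<phi>s)
  case Nil
  show ?case by (rule runsI) (simp add: step_body_def step_def)
next
  case (Cons \<phi> \<phi>s)
  have eq: "step rs (\<phi> # \<phi>s) = derivs \<phi> rs (step rs \<phi>s)"
    by (simp add: step_def)
  with Cons.prems have *: "nodes_fms (step rs \<phi>s) \<le> B"
    using nodes_derivs order_trans by metis
  have "prun 21 [encode_fm \<phi>, encode_list (map encode_mask rs), encode_list (map encode_fm (step rs \<phi>s))]
      (encode_list (map encode_fm (step rs (\<phi> # \<phi>s)))) (length rs * (50 * M + 40 * B + 50) + 10)"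
    unfolding eq by (rule runs_mono[OF run_derivs[where B = B]]) (use Cons.prems eq in auto)
  with Cons * show ?case
    by (intro runsI) (auto simp: step_body_def algebra_simps
      intro!: Cons.IH[THEN wpc_runs] elim!: wpc_runs)
qed

text \<open>The list \<open>cs\<close> is a unary counter with arbitrary entries, so the rows of an
  adjacency matrix can count the steps. One bound \<open>B\<close> for all iterates gives the same
  cost for each of them.\<close>

lemma run_iterate:
  "(\<And>i. i \<le> length cs \<Longrightarrow> length ((step rs ^^ i) \<phi>s) \<le> B \<and> nodes_fms ((step rs ^^ i) \<phi>s) \<le> B \<and>
      (\<forall>\<phi>\<in>set ((step rs ^^ i) \<phi>s). nodes (encode_fm \<phi>) \<le> B)) \<Longrightarrow>
    prun 23 [encode_list cs, encode_list (map encode_fm \<phi>s), encode_list (map encode_mask rs)]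
      (encode_list (map encode_fm ((step rs ^^ length cs) \<phi>s)))
      (length cs * (B * (length rs * (90 * B + 50) + 50) + 50) + 10)"
proof (induction cs arbitrary: \<phi>s)
  case Nil
  show ?case by (rule runsI) (simp add: iterate_body_def)
next
  case (Cons c cs)
  have B0: "length \<phi>s \<le> B" "\<forall>\<phi>\<in>set \<phi>s. nodes (encode_fm \<phi>) \<le> B"
    using Cons.prems[of 0] by auto
  have B1: "nodes_fms (step rs \<phi>s) \<le> B" using Cons.prems[of 1] by simp
  have IH: "prun 23 [encode_list cs, encode_list (map encode_fm (step rs \<phi>s)), encode_list (map encode_mask rs)]
      (encode_list (map encode_fm ((step rs ^^ length cs) (step rs \<phi>s))))
      (length cs * (B * (length rs * (90 * B + 50) + 50) + 50) + 10)"
    by (rule Cons.IH) (use Cons.prems[of "Suc _"] in \<open>simp add: funpow_swap1\<close>)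
  have "prun 22 [encode_list (map encode_fm \<phi>s), encode_list (map encode_mask rs)]
      (encode_list (map encode_fm (step rs \<phi>s)))
      (B * (length rs * (90 * B + 50) + 50) + 10)"
    by (rule runs_mono[OF run_step[OF B1 B0(2)]]) (use B0(1) in \<open>auto intro!: add_mono mult_mono\<close>)
  with IH show ?case
    by (intro runsI) (auto simp: iterate_body_def funpow_swap1 algebra_simps elim!: wpc_runs)
qed

primrec holds_at_0 :: "fm \<Rightarrow> bool" where
  "holds_at_0 (Atom A d) \<longleftrightarrow> d = 0"
| "holds_at_0 (Nand \<phi> \<psi>) \<longleftrightarrow> \<not> (holds_at_0 \<phi> \<and> holds_at_0 \<psi>)"

lemma run_holds: "prun 24 [encode_fm \<phi>] (encode_bool (holds_at_0 \<phi>)) (20 * nodes (encode_fm \<phi>))"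
proof (induction \<phi>)
  case (Atom A d)
  then show ?case by (cases d) (auto simp: holds_body_def intro!: runsI)
next
  case (Nand \<phi> \<psi>)
  then show ?case
    by (intro runsI) (auto simp: holds_body_def intro!: Nand.IH[THEN wpc_runs])
qed

lemma run_any:
  "prun 25 [encode_list (map encode_fm \<phi>s)] (encode_bool (\<exists>\<phi>\<in>set \<phi>s. holds_at_0 \<phi>)) (30 * nodes_fms \<phi>s)"
proof (induction \<phi>s)
  case Nil
  show ?case by (rule runsI) (simp add: any_body_def)
next
  case (Cons \<phi> \<phi>s)
  then show ?case
    by (intro runsI) (auto simp: any_body_def intro!: run_holds[THEN wpc_runs] Cons.IH[THEN wpc_runs])
qed

section \<open>The threshold as a capped unary number\<close>

lemma run_cap: "prun 26 [encode_unary m, encode_list xs] (encode_unary (min m (length xs))) (20 * (length xs + 1))"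
proof (induction xs arbitrary: m)
  case Nil
  show ?case by (cases m) (auto simp: cap_body_def intro!: runsI)
next
  case (Cons x xs)
  then show ?case
    by (cases m) (auto simp: cap_body_def intro!: runsI Cons.IH[THEN wpc_runs])
qed

lemma run_append: "prun 27 [encode_unary m, encode_unary n] (encode_unary (m + n)) (20 * (m + 1))"
proof (induction m)
  case 0
  show ?case by (rule runsI) (simp add: append_body_def)
next
  case (Suc m)
  then show ?case
    by (intro runsI) (auto simp: append_body_def intro!: Suc.IH[THEN wpc_runs])
qed

lemma run_double: "prun 28 [encode_unary m] (encode_unary (2 * m)) (20 * (m + 2))"
  by (rule runsI) (auto simp: double_body_def mult_2 intro!: run_append[THEN wpc_runs])

definition bits_value :: "bool list \<Rightarrow> nat" where
  "bits_value bs = foldr (\<lambda>b v. of_bool b + 2 * v) bs 0"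

lemma bits_value_simps [simp]:
  "bits_value [] = 0" "bits_value (b # bs) = of_bool b + 2 * bits_value bs"
  by (simp_all add: bits_value_def)

lemma bits_value_binary_digits: "bits_value (binary_digits n) = n"
proof (induction n rule: less_induct)
  case (less n)
  then show ?case by (subst binary_digits.simps) (auto simp: odd_iff_mod_2_eq_one)
qed

text \<open>A binary number can be exponentially large in its length. Capping after each digit keeps
  every intermediate unary number at most about twice the cap.\<close>

lemma run_value:
  "prun 29 [encode_mask bs, encode_list xs] (encode_unary (min (bits_value bs) (length xs)))
    (length bs * (40 * length xs + 100) + 10)"
proof (induction bs)
  case Nil
  show ?case by (rule runsI) (simp add: value_body_def)
next
  case (Cons b bs)
  let ?v = "min (bits_value bs) (length xs)"
  note cap = run_cap[of "Suc (2 * ?v)", THEN wpc_runs, simplified] run_cap[THEN wpc_runs]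
  \<comment> \<open>Capping before doubling is harmless: once the cap is reached, doubling stays
    above it.\<close>
  have "min (2 * ?v) (length xs) = min (2 * bits_value bs) (length xs)"
    "min (Suc (2 * ?v)) (length xs) = min (Suc (2 * bits_value bs)) (length xs)" by auto
  then show ?case
    by (intro runsI, cases b) (auto simp: value_body_def simp del: min_less_iff_conj
      intro!: cap run_double[THEN wpc_runs] Cons.IH[THEN wpc_runs])
qed

section \<open>Formulas over class counts\<close>

definition weight :: "bool list \<Rightarrow> (nat \<Rightarrow> nat) \<Rightarrow> nat" where
  "weight A x = (\<Sum>i<length A. if A ! i then x i else 0)"

definition entry :: "bool list \<Rightarrow> nat \<Rightarrow> nat" where
  "entry r i = of_bool (i < length r \<and> r ! i)"

lemma weight_simps [simp]:
  "weight [] x = 0"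
  "weight (a # A) x = (if a then x 0 else 0) + weight A (\<lambda>i. x (Suc i))"
  unfolding weight_def by (simp_all add: sum.lessThan_Suc_shift del: sum.lessThan_Suc)

lemma entry_simps [simp]:
  "entry [] = (\<lambda>_. 0)" "entry (b # r) 0 = of_bool b" "entry (b # r) (Suc i) = entry r i"
  by (auto simp: entry_def)

lemma weight_0 [simp]: "weight A (\<lambda>_. 0) = 0"
  by (simp add: weight_def)

lemma overlap_eq_weight: "overlap A r = weight A (entry r)"
  by (induction A r rule: overlap.induct) auto

lemma overlap_le_length: "overlap A r \<le> length A"
  by (induction A r rule: overlap.induct) auto

lemma weight_add: "weight A (\<lambda>i. x i + y i) = weight A x + weight A y"
  unfolding weight_def sum.distrib[symmetric] by (intro sum.cong) auto

lemma weight_mono: "(\<And>i. i < length A \<Longrightarrow> x i \<le> y i) \<Longrightarrow> weight A x \<le> weight A y"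
  unfolding weight_def by (intro sum_mono) auto

section \<open>Satisfaction and binary digits\<close>

primrec sat :: "(nat \<Rightarrow> nat) \<Rightarrow> fm \<Rightarrow> bool" where
  "sat x (Atom A d) \<longleftrightarrow> d \<le> weight A x"
| "sat x (Nand \<phi> \<psi>) \<longleftrightarrow> \<not> (sat x \<phi> \<and> sat x \<psi>)"

text \<open>With \<open>w\<close> the weight of \<open>y\<close> and \<open>p\<close> the overlap of
  the digits with \<open>A\<close>, the condition \<open>d \<le> 2 * w + p\<close> says that half of
  \<open>d - p\<close>, rounded up, is at most \<open>w\<close>. Truncation agrees with this: for
  \<open>d \<le> p\<close> both sides hold.\<close>

lemma sat_deriv: "sat y (deriv_fm r \<phi>) \<longleftrightarrow> sat (\<lambda>i. 2 * y i + entry r i) \<phi>"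
proof (induction \<phi>)
  case (Atom A d)
  have "weight A (\<lambda>i. 2 * y i + entry r i) = 2 * weight A y + overlap A r"
    by (simp add: weight_add mult_2 overlap_eq_weight)
  then show ?case by (auto simp: half_def)
qed auto

lemma holds_at_0_iff: "holds_at_0 \<phi> \<longleftrightarrow> sat (\<lambda>_. 0) \<phi>"
  by (induction \<phi>) auto

lemma set_masks: "set (masks k) = {r. length r = k}"
proof (induction k)
  case (Suc k)
  have "set (extend xs) = (\<Union>x\<in>set xs. {True # x, False # x})" for xs
    by (induction xs) auto
  with Suc show ?case
    by (auto simp: length_Suc_conv)
qed auto

lemma hd_masks: "masks k \<noteq> [] \<and> hd (masks k) = replicate k True"
proof (induction k)
  case (Suc k)
  then show ?case by (cases "masks k") auto
qed simp

lemma set_derivs: "set (derivs \<phi> rs acc) = (\<lambda>r. deriv_fm r \<phi>) ` set rs \<union> set acc"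
  unfolding derivs_def by (induction rs) auto

lemma set_step: "set (step rs \<phi>s) = (\<Union>\<phi>\<in>set \<phi>s. (\<lambda>r. deriv_fm r \<phi>) ` set rs)"
  unfolding step_def by (induction \<phi>s) (auto simp: set_derivs)

lemma distinct_derivs: "distinct acc \<Longrightarrow> distinct (derivs \<phi> rs acc)"
  unfolding derivs_def by (induction rs) auto

lemma distinct_step: "distinct (step rs \<phi>s)"
  unfolding step_def by (induction \<phi>s) (auto simp: distinct_derivs)

lemma entry_beyond: "length r = K \<Longrightarrow> i \<ge> K \<Longrightarrow> entry r i = 0"
  by (simp add: entry_def)

text \<open>The first step guesses the lowest digit of every count. Vectors below
  \<open>2 ^ Suc n\<close> thus correspond to pairs of a digit vector and a vector below
  \<open>2 ^ n\<close>, and with no digits left only the zero vector remains.\<close>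

lemma iterate_step_correct:
  "(\<exists>\<phi>\<in>set ((step (masks K) ^^ n) \<phi>s). holds_at_0 \<phi>) \<longleftrightarrow>
    (\<exists>\<phi>\<in>set \<phi>s. \<exists>x. (\<forall>i. x i < 2 ^ n) \<and> (\<forall>i\<ge>K. x i = 0) \<and> sat x \<phi>)"
proof (induction n arbitrary: \<phi>s)
  case 0
  have "(\<forall>i. x i < 2 ^ 0) \<longleftrightarrow> x = (\<lambda>_. 0)" for x :: "nat \<Rightarrow> nat" by auto
  then show ?case by (auto simp: holds_at_0_iff)
next
  case (Suc n)
  have bits: "(\<exists>r. length r = K \<and> (\<exists>x. (\<forall>i. x i < 2 ^ n) \<and> (\<forall>i\<ge>K. x i = 0) \<and> sat x (deriv_fm r \<phi>))) \<longleftrightarrow>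
    (\<exists>x. (\<forall>i. x i < 2 ^ Suc n) \<and> (\<forall>i\<ge>K. x i = 0) \<and> sat x \<phi>)" (is "?l \<longleftrightarrow> ?r") for \<phi>
  proof
    assume ?l
    then obtain r x where rx: "length r = K" "\<forall>i. x i < 2 ^ n" "\<forall>i\<ge>K. x i = 0" "sat x (deriv_fm r \<phi>)"
      by blast
    have "2 * x i + entry r i < 2 ^ Suc n" for i
      using rx(2)[rule_format, of i] by (simp add: entry_def)
    with rx show ?r
      by (intro exI[of _ "\<lambda>i. 2 * x i + entry r i"]) (auto simp: sat_deriv entry_beyond)
  next
    assume ?r
    then obtain x where x: "\<forall>i. x i < 2 ^ Suc n" "\<forall>i\<ge>K. x i = 0" "sat x \<phi>" by blast
    let ?r = "map (\<lambda>i. odd (x i)) [0..<K]"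
    have "(\<lambda>i. 2 * (x i div 2) + entry ?r i) = x"
    proof
      fix i
      show "2 * (x i div 2) + entry ?r i = x i"
      proof (cases "i < K")
        case True
        then show ?thesis by (simp add: entry_def flip: mod_2_eq_odd)
      next
        case False
        then show ?thesis using x(2) by (simp add: entry_def)
      qed
    qed
    moreover have "x i div 2 < 2 ^ n" for i
      using x(1)[rule_format, of i] by auto
    ultimately show ?l
      using x by (intro exI[of _ ?r] conjI exI[of _ "\<lambda>i. x i div 2"]) (auto simp: sat_deriv)
  qed
  have "(\<exists>\<phi>\<in>set ((step (masks K) ^^ Suc n) \<phi>s). holds_at_0 \<phi>) \<longleftrightarrow>
    (\<exists>\<psi>\<in>set (step (masks K) \<phi>s). \<exists>x. (\<forall>i. x i < 2 ^ n) \<and> (\<forall>i\<ge>K. x i = 0) \<and> sat x \<psi>)"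
    unfolding funpow_Suc_right o_def by (rule Suc.IH)
  also have "\<dots> \<longleftrightarrow> (\<exists>\<phi>\<in>set \<phi>s. \<exists>r. length r = K \<and>
      (\<exists>x. (\<forall>i. x i < 2 ^ n) \<and> (\<forall>i\<ge>K. x i = 0) \<and> sat x (deriv_fm r \<phi>)))"
    by (simp only: set_step set_masks bex_UN bex_simps)
  finally show ?case
    unfolding bits .
qed

text \<open>
  Derivatives of the same order with respect to different digits differ only in the demands, and
  these stay within \<open>K\<close> of the demands of the derivative with respect to zeros: halving compensates
  the loss of at most \<open>K\<close> per digit. This bounds the number of formulas in each step by a function
  of \<open>K\<close>.
\<close>

primrec near :: "nat \<Rightarrow> fm \<Rightarrow> fm \<Rightarrow> bool" where
  "near K (Atom A d) \<phi> \<longleftrightarrow> (\<exists>d'. \<phi> = Atom A d' \<and> d' \<le> d \<and> d \<le> d' + K)"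
| "near K (Nand \<phi>1 \<phi>2) \<phi> \<longleftrightarrow> (\<exists>\<psi>1 \<psi>2. \<phi> = Nand \<psi>1 \<psi>2 \<and> near K \<phi>1 \<psi>1 \<and> near K \<phi>2 \<psi>2)"

primrec atoms_within :: "nat \<Rightarrow> nat \<Rightarrow> fm \<Rightarrow> bool" where
  "atoms_within K D (Atom A d) \<longleftrightarrow> length A \<le> K \<and> d \<le> D"
| "atoms_within K D (Nand \<phi> \<psi>) \<longleftrightarrow> atoms_within K D \<phi> \<and> atoms_within K D \<psi>"

primrec num_atoms :: "fm \<Rightarrow> nat" where
  "num_atoms (Atom A d) = 1"
| "num_atoms (Nand \<phi> \<psi>) = num_atoms \<phi> + num_atoms \<psi>"

lemma near_refl: "near K \<phi> \<phi>"
  by (induction \<phi>) auto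

lemma near_deriv:
  "near K \<rho> \<phi> \<Longrightarrow> atoms_within K D \<rho> \<Longrightarrow> near K (deriv_fm [] \<rho>) (deriv_fm r \<phi>)"
proof (induction \<rho> arbitrary: \<phi>)
  case (Atom A d)
  then obtain d' where d': "\<phi> = Atom A d'" "d' \<le> d" "d \<le> d' + K" by auto
  have "overlap A r \<le> K" using Atom.prems(2) overlap_le_length[of A r] by auto
  with d' show ?case by (auto simp: half_def)
qed auto

lemma near_within: "near K \<rho> \<phi> \<Longrightarrow> atoms_within K' D \<rho> \<Longrightarrow> atoms_within K' D \<phi>"
  by (induction \<rho> arbitrary: \<phi>) auto

lemma near_num_atoms: "near K \<rho> \<phi> \<Longrightarrow> num_atoms \<phi> = num_atoms \<rho>"
  by (induction \<rho> arbitrary: \<phi>) auto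

lemma deriv_within: "atoms_within K D \<phi> \<Longrightarrow> atoms_within K D (deriv_fm r \<phi>)"
  by (induction \<phi>) (auto simp: half_def)

lemma num_atoms_deriv [simp]: "num_atoms (deriv_fm r \<phi>) = num_atoms \<phi>"
  by (induction \<phi>) auto

text \<open>A formula near \<open>\<rho>\<close> shares its shape and masks, so it is determined by
  its demands, with at most \<open>K + 1\<close> choices for each atom.\<close>

lemma card_near: "finite {\<phi>. near K \<rho> \<phi>} \<and> card {\<phi>. near K \<rho> \<phi>} \<le> (K + 1) ^ num_atoms \<rho>"
proof (induction \<rho>)
  case (Atom A d)
  have sub: "{\<phi>. near K (Atom A d) \<phi>} \<subseteq> Atom A ` {d - K..d}" by auto
  have "card (Atom A ` {d - K..d}) \<le> K + 1"
    using card_image_le[of "{d - K..d}" "Atom A"] by simp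
  with card_mono[OF _ sub] show ?case
    using finite_subset[OF sub] by force
next
  case (Nand \<phi> \<psi>)
  have eq: "{\<chi>. near K (Nand \<phi> \<psi>) \<chi>} = case_prod Nand ` ({\<chi>. near K \<phi> \<chi>} \<times> {\<chi>. near K \<psi> \<chi>})" (is "_ = ?I")
    by auto
  have "card ?I \<le> card {\<chi>. near K \<phi> \<chi>} * card {\<chi>. near K \<psi> \<chi>}"
    using Nand card_image_le[of "{\<chi>. near K \<phi> \<chi>} \<times> {\<chi>. near K \<psi> \<chi>}"]
    by (metis card_cartesian_product finite_cartesian_product)
  also have "\<dots> \<le> (K + 1) ^ num_atoms \<phi> * (K + 1) ^ num_atoms \<psi>"
    using Nand by (intro mult_mono) auto
  finally show ?case
    unfolding eq using Nand by (simp add: power_add)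
qed

lemma nodes_encode_mask: "nodes (encode_mask A) \<le> 4 * length A + 1"
proof (induction A)
  case (Cons a A)
  then show ?case by (cases a) auto
qed simp

lemma nodes_encode_fm:
  "atoms_within K D \<phi> \<Longrightarrow> nodes (encode_fm \<phi>) + 1 \<le> num_atoms \<phi> * (4 * K + 2 * D + 10)"
proof (induction \<phi>)
  case (Atom A d)
  then show ?case using nodes_encode_mask[of A] by simp
next
  case (Nand \<phi> \<psi>)
  then show ?case by (simp add: algebra_simps)
qed

lemma nodes_fms_le:
  "\<forall>\<phi>\<in>set \<phi>s. nodes (encode_fm \<phi>) + 1 \<le> M \<Longrightarrow> nodes_fms \<phi>s \<le> length \<phi>s * M + 1"
  by (induction \<phi>s) auto

lemma near_iterate_step:
  assumes "atoms_within K D \<phi>" "\<psi> \<in> set ((step rs ^^ i) [\<phi>])"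
  shows "near K ((deriv_fm [] ^^ i) \<phi>) \<psi> \<and> atoms_within K D ((deriv_fm [] ^^ i) \<phi>)"
  using assms(2)
proof (induction i arbitrary: \<psi>)
  case 0
  then show ?case using assms(1) by (simp add: near_refl)
next
  case (Suc i)
  then obtain \<chi> r where "\<chi> \<in> set ((step rs ^^ i) [\<phi>])" "\<psi> = deriv_fm r \<chi>"
    by (auto simp: set_step)
  with Suc.IH[of \<chi>] show ?case
    by (auto intro: near_deriv deriv_within)
qed

lemma num_atoms_iterate [simp]: "num_atoms ((deriv_fm r ^^ i) \<phi>) = num_atoms \<phi>"
  by (induction i) auto

text \<open>The demand bound \<open>D\<close>, which will grow with the graph, affects only the size
  \<open>M\<close> of one formula. The number \<open>Q\<close> of formulas comes from the window
  width and the number of atoms.\<close>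

lemma iterate_step_size:
  fixes \<phi> D K
  defines "M \<equiv> num_atoms \<phi> * (4 * K + 2 * D + 10)" and "Q \<equiv> (K + 1) ^ num_atoms \<phi>"
  assumes within: "atoms_within K D \<phi>"
  shows "length ((step rs ^^ i) [\<phi>]) \<le> Q * M + 1 \<and> nodes_fms ((step rs ^^ i) [\<phi>]) \<le> Q * M + 1 \<and>
      (\<forall>\<psi>\<in>set ((step rs ^^ i) [\<phi>]). nodes (encode_fm \<psi>) \<le> Q * M + 1)"
proof -
  let ?\<phi>s = "(step rs ^^ i) [\<phi>]"
  note * = near_iterate_step[OF within]
  have nodes: "nodes (encode_fm \<psi>) + 1 \<le> M" if "\<psi> \<in> set ?\<phi>s" for \<psi>
    using nodes_encode_fm[of K D \<psi>] *[OF that] near_within near_num_atoms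
    unfolding M_def by (metis num_atoms_iterate)
  have "distinct ?\<phi>s" by (cases i) (auto simp: distinct_step)
  then have "length ?\<phi>s = card (set ?\<phi>s)" by (simp add: distinct_card)
  also have "\<dots> \<le> card {\<psi>. near K ((deriv_fm [] ^^ i) \<phi>) \<psi>}"
    using * card_near by (intro card_mono) auto
  also have "\<dots> \<le> Q"
    unfolding Q_def using card_near by (metis num_atoms_iterate)
  finally have len: "length ?\<phi>s \<le> Q" .
  have "M \<ge> 1"
  proof -
    have "num_atoms \<phi> \<ge> 1" by (induction \<phi>) auto
    then show ?thesis by (simp add: M_def)
  qed
  moreover have "Q \<ge> 1" by (simp add: Q_def)
  ultimately have QM: "Q \<le> Q * M" "M \<le> Q * M" by auto
  have "nodes_fms ?\<phi>s \<le> Q * M + 1"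
    using nodes_fms_le[of ?\<phi>s M] nodes mult_right_mono[OF len, of M] by (meson add_le_mono1 le_trans zero_le)
  moreover have "nodes (encode_fm \<psi>) \<le> Q * M + 1" if "\<psi> \<in> set ?\<phi>s" for \<psi>
    using nodes[OF that] QM by linarith
  moreover have "length ?\<phi>s \<le> Q * M + 1" using len QM(1) by linarith
  ultimately show ?thesis by blast
qed

section \<open>Alliance conditions on count vectors\<close>

definition adj :: "vertex_class list \<Rightarrow> nat \<Rightarrow> bool list" where "adj cs i = fst (snd (cs ! i))"
definition demand :: "vertex_class list \<Rightarrow> nat \<Rightarrow> nat" where "demand cs i = fst (snd (snd (cs ! i)))"
definition mult :: "vertex_class list \<Rightarrow> nat \<Rightarrow> nat" where "mult cs i = snd (snd (snd (cs ! i)))"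

definition unit_classes :: "vertex_class list \<Rightarrow> bool" where
  "unit_classes cs \<longleftrightarrow>
     (\<forall>i<length cs. fst (cs ! i) = map ((=) i) [0..<length cs] \<and> length (adj cs i) = length cs)"

definition alliance_counts :: "vertex_class list \<Rightarrow> (nat \<Rightarrow> nat) \<Rightarrow> bool" where
  "alliance_counts cs y \<longleftrightarrow> (\<exists>i<length cs. 0 < y i) \<and>
     (\<forall>i<length cs. 0 < y i \<longrightarrow> demand cs i \<le> weight (adj cs i) y)"

definition masked :: "bool list \<Rightarrow> (nat \<Rightarrow> nat) \<Rightarrow> nat \<Rightarrow> nat" where
  "masked R x i = (if i < length R \<and> R ! i then x i else 0)"

lemma weight_unit: "i < K \<Longrightarrow> weight (map ((=) i) [0..<K]) x = x i"
  by (simp add: weight_def)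

lemma weight_inter: "length A = length R \<Longrightarrow> weight (inter A R) x = weight A (masked R x)"
  unfolding weight_def masked_def by (intro sum.cong) auto

lemma weight_pos_iff: "Suc 0 \<le> weight R x \<longleftrightarrow> (\<exists>i<length R. 0 < masked R x i)"
  unfolding weight_def masked_def Suc_le_eq
  by (simp only: neq0_conv[symmetric] sum_eq_0_iff[OF finite_lessThan]) auto

context
  fixes x :: "nat \<Rightarrow> nat" and e :: "bool list"
  assumes e: "\<And>i. entry e i \<le> x i"
begin

text \<open>As \<open>e\<close> lies below \<open>x\<close>, the truncated subtraction is exact. A
  lower bound on the weight of \<open>x - e\<close> becomes one on the weight of \<open>x\<close>
  with a raised demand.\<close>

lemma weight_minus_entry: "weight A x = weight A (\<lambda>i. x i - entry e i) + overlap A e"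
  unfolding overlap_eq_weight weight_add[symmetric] using e by simp

lemma sat_restricted_atom:
  "length A = length R \<Longrightarrow>
    sat x (restricted_atom R e A d) \<longleftrightarrow> d \<le> weight A (masked R (\<lambda>i. x i - entry e i))"
  unfolding restricted_atom_def by (simp add: weight_minus_entry flip: weight_inter)

lemma sat_alliance_fm_aux:
  "class_masks (length R) cs \<Longrightarrow> sat x (alliance_fm R e cs) \<longleftrightarrow>
    Suc 0 \<le> weight R (\<lambda>i. x i - entry e i) \<and>
    (\<forall>(u, A, t, n)\<in>set cs. Suc 0 \<le> weight u (masked R (\<lambda>i. x i - entry e i)) \<longrightarrow>
      t \<le> weight A (masked R (\<lambda>i. x i - entry e i)))"
proof (induction cs)
  case Nil
  then show ?case by (simp add: weight_minus_entry Suc_le_eq)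
next
  case (Cons c cs)
  then show ?case by (cases c) (auto simp: class_masks_def sat_restricted_atom)
qed

end

lemma alliance_counts_mono:
  assumes "alliance_counts cs y" "unit_classes cs"
    "\<And>i. i < length cs \<Longrightarrow> y i \<le> z i" "\<And>i. i < length cs \<Longrightarrow> 0 < z i \<Longrightarrow> 0 < y i"
  shows "alliance_counts cs z"
proof -
  have "weight (adj cs i) y \<le> weight (adj cs i) z" if "i < length cs" for i
    using assms(2,3) that by (intro weight_mono) (simp add: unit_classes_def)
  then show ?thesis
    using assms(1,3,4) unfolding alliance_counts_def by (meson le_trans less_le_trans)
qed

lemma unit_classes_masks: "unit_classes cs \<Longrightarrow> class_masks (length cs) cs"
  unfolding unit_classes_def class_masks_def adj_def by (fastforce simp: in_set_conv_nth)

lemma ball_classes: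
  "(\<forall>(u, A, t, n)\<in>set cs. P u A t n) \<longleftrightarrow>
    (\<forall>i<length cs. P (fst (cs ! i)) (adj cs i) (demand cs i) (mult cs i))"
  unfolding adj_def demand_def mult_def all_set_conv_all_nth by (simp add: case_prod_beta)

lemma sat_alliance_fm:
  assumes "unit_classes cs" "length R = length cs" "\<And>i. entry e i \<le> x i"
  shows "sat x (alliance_fm R e cs) \<longleftrightarrow> alliance_counts cs (masked R (\<lambda>i. x i - entry e i))"
proof -
  have "weight (fst (cs ! i)) z = z i" if "i < length cs" for i z
    using assms(1) that by (simp add: unit_classes_def weight_unit)
  then show ?thesis
    unfolding sat_alliance_fm_aux[OF assms(3) unit_classes_masks[OF assms(1), folded assms(2)]]
      ball_classes alliance_counts_def weight_pos_iff[of R]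
    by (auto simp: assms(2) Suc_le_eq)
qed

lemma sat_no_smaller_fm:
  "sat x (no_smaller_fm u Rs cs) \<longleftrightarrow> (\<forall>R\<in>set Rs. \<not> (Suc 0 \<le> weight u x \<and> sat x (alliance_fm R u cs)))"
  by (induction Rs) auto

lemma sat_bounds_fm:
  "sat x (bounds_fm Rs all cs) \<longleftrightarrow> (\<forall>(u, A, t, n)\<in>set cs. weight u x \<le> n \<and> sat x (no_smaller_fm u Rs all))"
  by (induction Rs all cs rule: bounds_fm.induct) auto

definition main_fm :: "nat \<Rightarrow> vertex_class list \<Rightarrow> fm" where
  "main_fm k cs = And (alliance_fm (hd (masks (length cs))) [] cs)
     (And (Atom (hd (masks (length cs))) k) (bounds_fm (masks (length cs)) cs cs))"

lemma entry_unit: "i < K \<Longrightarrow> entry (map ((=) i) [0..<K]) j = of_bool (i = j)"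
  by (auto simp: entry_def)

text \<open>
  For minimality it suffices to consider \<open>y = x - e\<close>, restricted to a set \<open>R\<close> of classes, where \<open>e\<close> is
  a unit vector: every \<open>y < x\<close> lies below such a vector with the same support, and the alliance
  conditions for a fixed support are monotone.
\<close>

lemma sat_main_fm:
  assumes cs: "unit_classes cs" and x: "\<And>i. i \<ge> length cs \<Longrightarrow> x i = 0"
  shows "sat x (main_fm k cs) \<longleftrightarrow> alliance_counts cs x \<and> k \<le> (\<Sum>i<length cs. x i) \<and>
    (\<forall>i<length cs. x i \<le> mult cs i) \<and> (\<forall>y. (\<forall>i. y i \<le> x i) \<and> alliance_counts cs y \<longrightarrow> y = x)"
proof -
  let ?K = "length cs"
  let ?u = "\<lambda>D. map ((=) D) [0..<?K]"
  let ?minus = "\<lambda>R D. masked R (\<lambda>i. x i - of_bool (D = i))"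
  have full: "masked (replicate ?K True) x = x"
    using x by (auto simp: masked_def fun_eq_iff)
  have alliance: "sat x (alliance_fm (replicate ?K True) [] cs) \<longleftrightarrow> alliance_counts cs x"
    using sat_alliance_fm[OF cs, of "replicate ?K True" "[]" x] full by simp
  have size: "weight (replicate ?K True) x = (\<Sum>i<?K. x i)"
    by (simp add: weight_def)
  have bounds: "sat x (bounds_fm (masks ?K) cs cs) \<longleftrightarrow> (\<forall>i<?K. x i \<le> mult cs i) \<and>
    (\<forall>D<?K. \<forall>R. length R = ?K \<longrightarrow> \<not> (0 < x D \<and> alliance_counts cs (?minus R D)))"
  proof -
    have "sat x (no_smaller_fm (?u D) (masks ?K) cs) \<longleftrightarrow>
      (\<forall>R. length R = ?K \<longrightarrow> \<not> (0 < x D \<and> alliance_counts cs (?minus R D)))" if "D < ?K" for D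
    proof (cases "0 < x D")
      case True
      then have "entry (?u D) i \<le> x i" for i
        using that by (auto simp: entry_unit)
      then show ?thesis
        using sat_alliance_fm[OF cs, of _ "?u D" x] that True
        by (auto simp: sat_no_smaller_fm weight_unit set_masks entry_unit)
    next
      case False
      then show ?thesis using that by (auto simp: sat_no_smaller_fm weight_unit)
    qed
    moreover have "fst (cs ! i) = ?u i" if "i < ?K" for i
      using cs that by (simp add: unit_classes_def)
    ultimately show ?thesis
      unfolding sat_bounds_fm ball_classes by (auto simp: weight_unit)
  qed
  have minimal: "(\<forall>D<?K. \<forall>R. length R = ?K \<longrightarrow> \<not> (0 < x D \<and> alliance_counts cs (?minus R D))) \<longleftrightarrow>
    (\<forall>y. (\<forall>i. y i \<le> x i) \<and> alliance_counts cs y \<longrightarrow> y = x)" (is "?l \<longleftrightarrow> ?r")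
  proof
    assume l: ?l
    show ?r
    proof (intro allI impI, elim conjE, rule ccontr)
      fix y assume y: "\<forall>i. y i \<le> x i" "alliance_counts cs y" "y \<noteq> x"
      then obtain D where "y D \<noteq> x D" by blast
      with y(1) have D: "y D < x D" by (simp add: order_less_le)
      then have DK: "D < ?K" using x by (metis not_less less_nat_zero_code)
      let ?R = "map (\<lambda>i. 0 < y i) [0..<?K]"
      have "alliance_counts cs (?minus ?R D)"
      proof (rule alliance_counts_mono[OF y(2) cs])
        show "y i \<le> ?minus ?R D i" if "i < ?K" for i
          using y(1)[rule_format, of i] D that by (auto simp: masked_def)
      qed (auto simp: masked_def split: if_splits)
      then show False using l D DK by auto
    qed
  next
    assume r: ?r
    show ?l
    proof (intro allI impI notI, elim conjE)
      fix D R assume D: "D < ?K" "0 < x D" "alliance_counts cs (?minus R D)"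
      have "?minus R D = x"
        using r D(3) by (auto simp: masked_def)
      then have "?minus R D D = x D" by simp
      with D(2) show False by (simp add: masked_def split: if_splits)
    qed
  qed
  have "sat x (main_fm k cs) \<longleftrightarrow> sat x (alliance_fm (replicate ?K True) [] cs) \<and>
      k \<le> weight (replicate ?K True) x \<and> sat x (bounds_fm (masks ?K) cs cs)"
    unfolding main_fm_def hd_masks[THEN conjunct2] by auto
  then show ?thesis
    unfolding alliance size bounds minimal by blast
qed

section \<open>Graphs and class counts\<close>

lemma compress_map_left: "compress (map f xs) ks = map f (compress xs ks)"
  by (induction xs ks rule: compress.induct) auto

text \<open>Both functions keep the last occurrence of each element.\<close>

lemma compress_self: "compress keys keys = remdups keys"
proof -
  have "compress xs ks = remdups xs" if "xs = ks" for xs ks :: "'a list"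
    using that by (induction xs ks rule: compress.induct) auto
  then show ?thesis by simp
qed

lemma set_compress: "set (compress xs ks) \<subseteq> set xs"
  by (induction xs ks rule: compress.induct) auto

lemma count_list_map_True: "count_list (map P xs) True = length (filter P xs)"
  by (induction xs) auto

lemma count_list_map: "distinct xs \<Longrightarrow> count_list (map f xs) y = card {x \<in> set xs. f x = y}"
proof (induction xs)
  case (Cons x xs)
  have "{z. (z = x \<or> z \<in> set xs) \<and> f z = y} =
      (if f x = y then insert x {z \<in> set xs. f z = y} else {z \<in> set xs. f z = y})" by auto
  with Cons show ?case by simp
qed simp

section \<open>Chosen neighbourhoods in a graph\<close>

locale graph =
  fixes vs :: "'a list" and E :: "'a set set"
  assumes distinct: "distinct vs" and simple: "simple_graph (set vs) E"
begin

abbreviation "V \<equiv> set vs"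
abbreviation "N v \<equiv> neighbours E v"

definition row :: "'a \<Rightarrow> bool list" where "row v = map (\<lambda>w. {v, w} \<in> E) vs"
definition crow :: "'a \<Rightarrow> bool list" where "crow v = map (\<lambda>w. {v, w} \<in> E \<or> v = w) vs"
definition vkey :: "'a \<Rightarrow> vertex_key" where "vkey v = key (map crow vs) (row v) (crow v)"

definition clique_class :: "'a \<Rightarrow> bool" where
  "clique_class v \<longleftrightarrow> 2 \<le> count_list (map crow vs) (crow v)"

text \<open>This choice puts each class entirely inside or entirely outside of every chosen
  neighbourhood, including those of its own members.\<close>

definition nbhd :: "'a \<Rightarrow> 'a set" where
  "nbhd v = (if clique_class v then insert v (N v) else N v)"

text \<open>As a component of the key, the demand is by construction the same for all members of a
  class.\<close>

definition demand_of :: "'a \<Rightarrow> nat" where "demand_of v = snd (vkey v)"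

lemma N_subset: "N v \<subseteq> V" and N_irrefl: "v \<notin> N v" and N_sym: "u \<in> N v \<longleftrightarrow> v \<in> N u"
  using simple by (auto simp: simple_graph_def neighbours_def doubleton_eq_iff insert_commute)

lemma finite_N: "finite (N v)"
  using N_subset finite_subset by blast

lemma mem_N: "{v, w} \<in> E \<longleftrightarrow> w \<in> N v"
  by (simp add: neighbours_def insert_commute)

lemma fst_vkey: "fst (vkey v) = map (\<lambda>w. w \<in> nbhd v) vs"
  by (auto simp: vkey_def key_def clique_class_def nbhd_def row_def crow_def mem_N)

lemma crow_eq_iff: "u \<in> V \<Longrightarrow> v \<in> V \<Longrightarrow> crow u = crow v \<longleftrightarrow> insert u (N u) = insert v (N v)"
  unfolding crow_def mem_N using N_subset[of u] N_subset[of v] by auto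

lemma nbhd_subset: "v \<in> V \<Longrightarrow> nbhd v \<subseteq> V"
  using N_subset by (auto simp: nbhd_def)

lemma vkey_eq_nbhd:
  assumes "u \<in> V" "v \<in> V" "vkey u = vkey v"
  shows "nbhd u = nbhd v"
proof -
  have "\<forall>w\<in>V. w \<in> nbhd u \<longleftrightarrow> w \<in> nbhd v"
    using arg_cong[OF assms(3), of fst] by (simp add: fst_vkey)
  then show ?thesis using nbhd_subset assms by blast
qed

text \<open>By this symmetry, key-equal vertices lie in the same chosen neighbourhoods.\<close>

lemma nbhd_sym: "w \<in> nbhd u \<longleftrightarrow> u \<in> nbhd w"
  by (cases "u = w") (auto simp: nbhd_def N_sym[of u])

lemma nbhd_vkey:
  assumes "u \<in> V" "w \<in> V" "w' \<in> V" "vkey w = vkey w'"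
  shows "w \<in> nbhd u \<longleftrightarrow> w' \<in> nbhd u"
  using vkey_eq_nbhd[OF assms(2-4)] nbhd_sym by blast

lemma count_fst_vkey: "v \<in> V \<Longrightarrow> count_list (map (\<lambda>w. w \<in> nbhd v) vs) True = card (nbhd v)"
  using nbhd_subset[of v] distinct
  by (simp add: count_list_map_True distinct_card[symmetric] inf.absorb2 Int_def[symmetric]
      flip: set_filter) (simp add: Collect_conj_eq inf.absorb2)

lemma demand_of_eq:
  assumes "v \<in> V"
  shows "demand_of v = (if clique_class v then half (card (nbhd v)) else half (card (nbhd v) - 1))"
proof -
  have "demand_of v = (if clique_class v then half (count_list (fst (vkey v)) True)
      else half (count_list (fst (vkey v)) True - 1))"
    by (auto simp: demand_of_def vkey_def key_def clique_class_def)
  then show ?thesis unfolding fst_vkey count_fst_vkey[OF assms] .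
qed

text \<open>With \<open>d\<close> neighbours in \<open>S\<close> out of \<open>g\<close>, the
  condition is \<open>g \<le> 2 * d + 1\<close>, that is, \<open>d\<close> is at least half of
  \<open>g - 1\<close>, rounded up. Equivalently \<open>d + 1\<close> is at least half of
  \<open>g + 1\<close>, rounded up, which is the version for closed neighbourhoods since
  \<open>v\<close> is in \<open>S\<close>.\<close>

lemma defended_iff:
  assumes S: "S \<subseteq> V" "v \<in> S"
  shows "degree_in E (V - S) v \<le> degree_in E S v + 1 \<longleftrightarrow> demand_of v \<le> card (nbhd v \<inter> S)"
proof -
  have "card (N v) = card (N v \<inter> S) + card (N v \<inter> (V - S))"
    using N_subset[of v] finite_N by (subst card_Un_disjoint[symmetric]) (auto intro: arg_cong[where f = card])
  moreover have "card (insert v (N v)) = card (N v) + 1" "card (insert v (N v) \<inter> S) = card (N v \<inter> S) + 1"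
    using N_irrefl[of v] finite_N[of v] S by auto
  moreover have "v \<in> V" using S by blast
  ultimately show ?thesis
    unfolding degree_in_def demand_of_eq[OF \<open>v \<in> V\<close>] nbhd_def half_def
    by (cases "clique_class v") auto
qed

section \<open>Cells of equal keys and their counts\<close>

definition keys :: "vertex_key list" where "keys = map vkey vs"
definition reps :: "'a list" where "reps = compress vs keys"
definition cs :: "vertex_class list" where "cs = classes (compress keys keys) (compress keys keys) keys"

abbreviation "K \<equiv> length reps"

lemma compress_keys: "compress keys keys = map vkey reps"
  unfolding reps_def keys_def by (simp add: compress_map_left)

lemma distinct_reps: "distinct (map vkey reps)" and set_reps: "vkey ` set reps = vkey ` V"
proof -
  have "map vkey reps = remdups keys" using compress_keys compress_self by metis
  then show "distinct (map vkey reps)" "vkey ` set reps = vkey ` V"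
    by (metis distinct_remdups, metis keys_def set_map set_remdups)
qed

lemma reps_subset: "i < K \<Longrightarrow> reps ! i \<in> V"
  using set_compress[of vs keys] unfolding reps_def by (meson nth_mem subsetD)

lemma length_cs [simp]: "length cs = K"
  by (simp add: cs_def classes_def compress_keys)

lemma unit_classes_cs: "unit_classes cs"
  unfolding unit_classes_def adj_def length_cs
proof (intro allI impI conjI)
  fix i assume i: "i < K"
  have "vkey (reps ! i) = vkey (reps ! j) \<longleftrightarrow> i = j" if "j < K" for j
    using nth_eq_iff_index_eq[OF distinct_reps, of i j] i that by simp
  then show "fst (cs ! i) = map ((=) i) [0..<K]"
    using i by (auto simp: cs_def classes_def compress_keys intro!: nth_equalityI)
  show "length (fst (snd (cs ! i))) = K"
    using i by (simp add: cs_def classes_def compress_keys fst_vkey compress_map_left flip: reps_def)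
qed

lemma
  assumes "i < K"
  shows adj_cs: "adj cs i = map (\<lambda>w. w \<in> nbhd (reps ! i)) reps"
    and demand_cs: "demand cs i = demand_of (reps ! i)"
    and mult_cs: "mult cs i = card {v \<in> V. vkey v = vkey (reps ! i)}"
  using assms unfolding adj_def demand_def mult_def
  by (simp_all add: cs_def classes_def compress_keys fst_vkey compress_map_left demand_of_def
      count_list_map[OF distinct] keys_def reps_def)

definition cell :: "nat \<Rightarrow> 'a set" where "cell i = {v \<in> V. i < K \<and> vkey v = vkey (reps ! i)}"

definition counts :: "'a set \<Rightarrow> nat \<Rightarrow> nat" where "counts S i = card (S \<inter> cell i)"

lemma cell_subset: "cell i \<subseteq> V" by (auto simp: cell_def)

lemma finite_cell: "finite (cell i)" using cell_subset finite_subset by blast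

lemma cell_disjoint: "i \<noteq> j \<Longrightarrow> cell i \<inter> cell j = {}"
  using nth_eq_iff_index_eq[OF distinct_reps, of i j] by (auto simp: cell_def)

lemma in_cell: "v \<in> V \<Longrightarrow> \<exists>i<K. v \<in> cell i"
proof -
  assume v: "v \<in> V"
  then have "vkey v \<in> vkey ` set reps" using set_reps by blast
  then obtain i where "i < K" "vkey v = vkey (reps ! i)" by (auto simp: in_set_conv_nth)
  then show ?thesis using v by (auto simp: cell_def)
qed

text \<open>Inside the vertex set \<open>nbhd v\<close> is a disjoint union of cells, namely of
  those whose representatives it contains.\<close>

lemma weight_adj_counts:
  assumes S: "S \<subseteq> V" and i: "i < K" "v \<in> cell i"
  shows "weight (adj cs i) (counts S) = card (nbhd v \<inter> S)"
proof -
  have rep: "reps ! i \<in> V" "v \<in> V" "vkey v = vkey (reps ! i)"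
    using i reps_subset by (auto simp: cell_def)
  then have nb: "nbhd (reps ! i) = nbhd v" using vkey_eq_nbhd by metis
  let ?J = "{j. j < K \<and> reps ! j \<in> nbhd v}"
  have "weight (adj cs i) (counts S) = (\<Sum>j<K. if reps ! j \<in> nbhd v then counts S j else 0)"
    unfolding weight_def adj_cs[OF i(1)] nb by simp
  also have "\<dots> = (\<Sum>j\<in>?J. counts S j)"
    by (simp add: sum.inter_filter[symmetric] lessThan_def Collect_conj_eq)
  also have "\<dots> = card (\<Union>j\<in>?J. S \<inter> cell j)"
    unfolding counts_def using cell_disjoint finite_cell
    by (intro card_UN_disjoint[symmetric]) (auto simp: disjoint_iff)
  also have "(\<Union>j\<in>?J. S \<inter> cell j) = nbhd v \<inter> S"
  proof -
    have rep_iff: "reps ! j \<in> nbhd v \<longleftrightarrow> w \<in> nbhd v" if "w \<in> cell j" for w j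
      using that nbhd_vkey[of v "reps ! j" w] rep(2) reps_subset by (auto simp: cell_def)
    have "w \<in> (\<Union>j\<in>?J. S \<inter> cell j)" if w: "w \<in> nbhd v \<inter> S" for w
    proof -
      obtain j where "j < K" "w \<in> cell j" using in_cell[of w] S w by auto
      then show ?thesis using rep_iff w by auto
    qed
    then show ?thesis using rep_iff by auto
  qed
  finally show ?thesis .
qed

lemma defensive_alliance_iff:
  assumes S: "S \<subseteq> V"
  shows "defensive_alliance V E S \<longleftrightarrow> alliance_counts cs (counts S)"
proof -
  have pos: "0 < counts S i \<longleftrightarrow> (\<exists>v. v \<in> S \<inter> cell i)" for i
    unfolding counts_def using finite_cell by (auto simp: card_gt_0_iff)
  have "S \<noteq> {} \<longleftrightarrow> (\<exists>i<K. 0 < counts S i)"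
    using S in_cell unfolding pos by (metis IntD1 IntI all_not_in_conv subsetD)
  moreover have defended: "demand cs i \<le> weight (adj cs i) (counts S) \<longleftrightarrow>
      degree_in E (V - S) v \<le> degree_in E S v + 1" if "i < K" "v \<in> S \<inter> cell i" for i v
  proof -
    have "demand_of v = demand cs i"
      using that by (auto simp: demand_cs demand_of_def cell_def)
    then show ?thesis
      using that weight_adj_counts[OF S, of i v] defended_iff[OF S, of v] by simp
  qed
  have "(\<forall>v\<in>S. degree_in E (V - S) v \<le> degree_in E S v + 1) \<longleftrightarrow>
      (\<forall>i<K. 0 < counts S i \<longrightarrow> demand cs i \<le> weight (adj cs i) (counts S))" (is "?l \<longleftrightarrow> ?r")
  proof
    assume ?l
    show ?r
    proof (intro allI impI)
      fix i assume i: "i < K" "0 < counts S i"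
      then obtain v where v: "v \<in> S \<inter> cell i" using pos by blast
      with \<open>?l\<close> show "demand cs i \<le> weight (adj cs i) (counts S)"
        using defended[OF i(1) v] by simp
    qed
  next
    assume r: ?r
    show ?l
    proof
      fix v assume v: "v \<in> S"
      then obtain i where i: "i < K" "v \<in> S \<inter> cell i" using in_cell[of v] S by blast
      then have "0 < counts S i" using pos by blast
      then show "degree_in E (V - S) v \<le> degree_in E S v + 1" using r defended[OF i] i(1) by simp
    qed
  qed
  ultimately show ?thesis
    unfolding defensive_alliance_def alliance_counts_def length_cs using S by simp
qed

lemma ex_counts:
  assumes "\<And>i. i < K \<Longrightarrow> y i \<le> counts S i" "\<And>i. i \<ge> K \<Longrightarrow> y i = 0" "S \<subseteq> V"
  shows "\<exists>T\<subseteq>S. counts T = y"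
proof -
  have "\<exists>T\<subseteq>S \<inter> cell i. card T = y i" if "i < K" for i
    using obtain_subset_with_card_n[OF assms(1)[OF that, unfolded counts_def]] by blast
  then have "\<forall>i\<in>{..<K}. \<exists>T. T \<subseteq> S \<inter> cell i \<and> card T = y i" by blast
  from bchoice[OF this] obtain T where T: "\<And>i. i < K \<Longrightarrow> T i \<subseteq> S \<inter> cell i \<and> card (T i) = y i"
    by blast
  let ?U = "\<Union>i<K. T i"
  have "?U \<inter> cell i = T i" if i: "i < K" for i
  proof (intro equalityI subsetI)
    fix z assume "z \<in> ?U \<inter> cell i"
    then obtain j where j: "j < K" "z \<in> T j" "z \<in> cell i" by blast
    then have "z \<in> cell j" using T[OF j(1)] by blast
    then have "j = i" using cell_disjoint[of j i] j(3) by blast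
    then show "z \<in> T i" using j(2) by simp
  next
    fix z assume "z \<in> T i"
    then show "z \<in> ?U \<inter> cell i" using T[OF i] i by blast
  qed
  then have "counts ?U i = y i" for i
    using T[of i] assms(2)[of i] by (cases "i < K") (simp_all add: counts_def cell_def)
  then have "counts ?U = y" by (rule ext)
  moreover have "?U \<subseteq> S" using T by blast
  ultimately show ?thesis by blast
qed

lemma card_counts: "S \<subseteq> V \<Longrightarrow> card S = (\<Sum>i<K. counts S i)"
proof -
  assume S: "S \<subseteq> V"
  have "card (\<Union>i<K. S \<inter> cell i) = (\<Sum>i<K. counts S i)"
    unfolding counts_def using cell_disjoint finite_cell
    by (intro card_UN_disjoint) (auto simp: disjoint_iff)
  moreover have "(\<Union>i<K. S \<inter> cell i) = S" using S in_cell by blast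
  ultimately show ?thesis by simp
qed

lemma counts_beyond: "i \<ge> K \<Longrightarrow> counts S i = 0"
  by (simp add: counts_def cell_def)

lemma counts_mono: "T \<subseteq> S \<Longrightarrow> counts T i \<le> counts S i"
  unfolding counts_def using finite_cell by (intro card_mono) auto

text \<open>Every vector below the counts of \<open>S\<close> is realised by a subset of
  \<open>S\<close>. Conversely a proper subset cannot have the same counts, because they sum up to
  its cardinality.\<close>

lemma globally_minimal_iff:
  assumes S: "S \<subseteq> V"
  shows "globally_minimal_defensive_alliance V E S \<longleftrightarrow> alliance_counts cs (counts S) \<and>
    (\<forall>y. (\<forall>i. y i \<le> counts S i) \<and> alliance_counts cs y \<longrightarrow> y = counts S)"
proof -
  have "(\<forall>T. T \<subset> S \<longrightarrow> \<not> defensive_alliance V E T) \<longleftrightarrow>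
    (\<forall>y. (\<forall>i. y i \<le> counts S i) \<and> alliance_counts cs y \<longrightarrow> y = counts S)" (is "?l \<longleftrightarrow> ?r")
  proof
    assume l: ?l
    show ?r
    proof (intro allI impI, elim conjE)
      fix y assume y: "\<forall>i. y i \<le> counts S i" "alliance_counts cs y"
      have "y i = 0" if "i \<ge> K" for i using y(1) counts_beyond[OF that] by (metis le_zero_eq)
      then obtain T where T: "T \<subseteq> S" "counts T = y" using ex_counts[of y S] y(1) S by auto
      then have "defensive_alliance V E T" using defensive_alliance_iff[of T] y(2) S by auto
      then have "T = S" using l T(1) by blast
      then show "y = counts S" using T(2) by simp
    qed
  next
    assume r: ?r
    show ?l
    proof (intro allI impI notI)
      fix T assume T: "T \<subset> S" "defensive_alliance V E T"
      then have "counts T = counts S"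
        using r counts_mono[of T S] defensive_alliance_iff[of T] S by auto
      then have "card T = card S" using card_counts[of T] card_counts[of S] T(1) S by auto
      then show False using psubset_card_mono[OF _ T(1)] finite_subset[OF S] by simp
    qed
  qed
  then show ?thesis
    unfolding globally_minimal_defensive_alliance_def defensive_alliance_iff[OF S] by blast
qed

lemma sat_main_fm_cs:
  assumes "\<forall>i\<ge>K. x i = 0"
  shows "sat x (main_fm k cs) \<longleftrightarrow> alliance_counts cs x \<and> k \<le> (\<Sum>i<K. x i) \<and>
    (\<forall>i<K. x i \<le> mult cs i) \<and> (\<forall>y. (\<forall>i. y i \<le> x i) \<and> alliance_counts cs y \<longrightarrow> y = x)"
  by (rule sat_main_fm[OF unit_classes_cs, unfolded length_cs]) (use assms in simp)

lemma sat_main_fm_iff: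
  "(\<exists>x. (\<forall>i\<ge>K. x i = 0) \<and> (\<forall>i. x i < 2 ^ length vs) \<and> sat x (main_fm k cs)) \<longleftrightarrow>
    (\<exists>S. globally_minimal_defensive_alliance V E S \<and> k \<le> card S)" (is "?l \<longleftrightarrow> ?r")
proof
  assume ?l
  then obtain x where x0: "\<forall>i\<ge>K. x i = 0" and "sat x (main_fm k cs)" by blast
  note x = this(2)[unfolded sat_main_fm_cs[OF x0]]
  \<comment> \<open>The size conjuncts of the formula ensure that enough vertices exist in each cell
    to realise \<open>x\<close>.\<close>
  have "mult cs i = counts V i" if "i < K" for i
    unfolding mult_cs[OF that] counts_def using that
    by (intro arg_cong[where f = card]) (auto simp: cell_def)
  then have "x i \<le> counts V i" if "i < K" for i using x that by simp
  then obtain S where S: "S \<subseteq> V" "counts S = x"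
    using ex_counts[of x V] x0 by auto
  have "globally_minimal_defensive_alliance V E S"
    unfolding globally_minimal_iff[OF S(1)] S(2) using x by blast
  moreover have "k \<le> card S" unfolding card_counts[OF S(1)] S(2) using x by blast
  ultimately show ?r by blast
next
  assume ?r
  then obtain S where S: "globally_minimal_defensive_alliance V E S" "k \<le> card S" by blast
  then have SV: "S \<subseteq> V" by (simp add: globally_minimal_defensive_alliance_def defensive_alliance_def)
  have "counts S i \<le> card V" for i
    unfolding counts_def using cell_subset[of i] by (intro card_mono) auto
  \<comment> \<open>No count exceeds the number of vertices, which is below two to its own power; so
    this many binary digits suffice.\<close>
  then have less: "\<forall>i. counts S i < 2 ^ length vs"
    using less_exp[of "length vs"] card_length[of vs] by (meson le_less_trans le_trans)
  moreover have "counts S i \<le> mult cs i" if "i < K" for i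
    unfolding mult_cs[OF that] counts_def using that by (intro card_mono) (auto simp: cell_def)
  moreover have beyond: "\<forall>i\<ge>K. counts S i = 0" by (simp add: counts_beyond)
  ultimately have "sat (counts S) (main_fm k cs)"
    using S(1)[unfolded globally_minimal_iff[OF SV]] S(2)[unfolded card_counts[OF SV]]
    unfolding sat_main_fm_cs[OF beyond] by blast
  with less beyond show ?l by blast
qed

section \<open>Comparison with the neighbourhood diversity\<close>

lemma twins_vkey:
  assumes uv: "u \<in> V" "v \<in> V" and twins: "N u - {v} = N v - {u}"
  shows "vkey u = vkey v"
proof (cases "u = v")
  case False
  have clique: "clique_class w" if w: "w \<in> V" "w' \<in> V" "w \<noteq> w'" "insert w (N w) = insert w' (N w')" for w w'
  proof -
    have "crow w = crow w'" unfolding crow_eq_iff[OF w(1,2)] by (rule w(4))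
    then have "{w, w'} \<subseteq> {z \<in> V. crow z = crow w}" using w(1,2) by simp
    then have "card {w, w'} \<le> card {z \<in> V. crow z = crow w}" by (intro card_mono) simp_all
    then show ?thesis
      using w(3) by (simp add: clique_class_def count_list_map[OF distinct])
  qed
  \<comment> \<open>A closed twin \<open>z\<close> of \<open>w\<close> would lie in
    \<open>N w = N w'\<close>. Then \<open>w'\<close> lies in the closed neighbourhood of
    \<open>z\<close>, which is that of \<open>w\<close>, and as \<open>w'\<close> differs from
    \<open>w\<close> it lies in \<open>N w = N w'\<close>, against irreflexivity.\<close>
  have open_twin: "\<not> clique_class w" if w: "w \<in> V" "w' \<in> V" "w \<noteq> w'" "N w = N w'" for w w'
  proof
    assume "clique_class w"
    then have "2 \<le> card {z \<in> V. crow z = crow w}"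
      by (simp add: clique_class_def count_list_map[OF distinct])
    moreover have "card {z \<in> V. crow z = crow w} \<le> card {w}" if "{z \<in> V. crow z = crow w} \<subseteq> {w}"
      using that by (intro card_mono) simp_all
    ultimately have "\<not> {z \<in> V. crow z = crow w} \<subseteq> {w}" by force
    then obtain z where z: "z \<in> V" "z \<noteq> w" "crow z = crow w" by blast
    then have z: "insert z (N z) = insert w (N w)" "z \<noteq> w"
      using crow_eq_iff[OF z(1) w(1)] by simp_all
    have "z \<in> insert w (N w)" unfolding z(1)[symmetric] by simp
    then have "z \<in> N w'" using z(2) w(4) by simp
    then have "w' \<in> insert z (N z)" using N_sym[of w' z] by simp
    then have "w' \<in> N w" unfolding z(1) using w(3) by simp
    then show False using w(4) N_irrefl by simp
  qed
  show ?thesis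
  proof (cases "u \<in> N v")
    case True
    then have "v \<in> N u" using N_sym[of u v] by simp
    have eq: "insert u (N u) = insert v (N v)"
    proof (rule set_eqI)
      show "x \<in> insert u (N u) \<longleftrightarrow> x \<in> insert v (N v)" for x
        using eqset_imp_iff[OF twins, of x] True \<open>v \<in> N u\<close> by (cases "x = u"; cases "x = v") simp_all
    qed
    then have "crow u = crow v" using crow_eq_iff[OF uv] by simp
    moreover have "clique_class u" by (rule clique[OF uv False eq])
    ultimately show ?thesis by (simp add: vkey_def key_def clique_class_def)
  next
    case no: False
    then have "v \<notin> N u" using N_sym[of u v] by simp
    have eq: "N u = N v"
    proof (rule set_eqI)
      show "x \<in> N u \<longleftrightarrow> x \<in> N v" for x
        using eqset_imp_iff[OF twins, of x] no \<open>v \<notin> N u\<close> N_irrefl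
        by (cases "x = u"; cases "x = v") simp_all
    qed
    then have "row u = row v" by (simp add: row_def mem_N)
    moreover have "\<not> clique_class u" "\<not> clique_class v"
      using open_twin[OF uv False eq] open_twin[OF uv(2,1) _ eq[symmetric]] False by auto
    ultimately show ?thesis by (simp add: vkey_def key_def clique_class_def)
  qed
qed simp

lemma K_le_neighbourhood_diversity: "K \<le> neighbourhood_diversity V E"
proof -
  let ?P = "\<lambda>k. \<exists>P. partition_on V P \<and> finite P \<and> card P = k \<and>
        (\<forall>C\<in>P. \<forall>u\<in>C. \<forall>v\<in>C. N u - {v} = N v - {u})"
  \<comment> \<open>The partition into singletons is admissible, so the minimum in the definition is
    attained.\<close>
  have "?P (card ((\<lambda>v. {v}) ` V))"
    by (intro exI[of _ "(\<lambda>v. {v}) ` V"]) (auto simp: partition_on_def disjoint_def)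
  then have "?P (neighbourhood_diversity V E)"
    unfolding neighbourhood_diversity_def by (rule LeastI)
  then obtain P where P: "partition_on V P" "finite P" "card P = neighbourhood_diversity V E"
    "\<forall>C\<in>P. \<forall>u\<in>C. \<forall>v\<in>C. N u - {v} = N v - {u}" by blast
  \<comment> \<open>Keys are constant on each part of a twin partition, so one vertex per part
    already yields all of them.\<close>
  have "vkey ` V \<subseteq> (\<lambda>C. vkey (SOME v. v \<in> C)) ` P"
  proof (rule image_subsetI)
    fix v assume "v \<in> V"
    then obtain C where C: "C \<in> P" "v \<in> C" using P(1) by (auto simp: partition_on_def)
    then have w: "(SOME v. v \<in> C) \<in> C" by (rule_tac someI)
    moreover have "C \<subseteq> V" using C P(1) by (auto simp: partition_on_def)
    ultimately have "(SOME v. v \<in> C) \<in> V" by (rule_tac subsetD)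
    then have "vkey v = vkey (SOME v. v \<in> C)"
      using twins_vkey[OF \<open>v \<in> V\<close>] P(4)[rule_format, OF C w] by simp
    then show "vkey v \<in> (\<lambda>C. vkey (SOME v. v \<in> C)) ` P" using C(1) by (rule image_eqI)
  qed
  then have "card (vkey ` V) \<le> card P" using P(2) surj_card_le by blast
  moreover have "K = card (vkey ` V)"
    using distinct_card[OF distinct_reps] set_reps by simp
  ultimately show ?thesis using P(3) by simp
qed

end

section \<open>Running time\<close>

lemma num_atoms_alliance_fm: "num_atoms (alliance_fm R e cs) = 4 * length cs + 1"
  by (induction R e cs rule: alliance_fm.induct) (auto simp: restricted_atom_def)

lemma num_atoms_no_smaller_fm:
  "num_atoms (no_smaller_fm u Rs cs) = length Rs * (4 * length cs + 3) + 1"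
  by (induction Rs) (auto simp: num_atoms_alliance_fm)

lemma num_atoms_bounds_fm:
  "num_atoms (bounds_fm Rs all cs) = length cs * (length Rs * (4 * length all + 3) + 5) + 1"
  by (induction Rs all cs rule: bounds_fm.induct) (auto simp: num_atoms_no_smaller_fm)

lemma num_atoms_main_fm:
  "num_atoms (main_fm k cs) = 4 * length cs + length cs * (2 ^ length cs * (4 * length cs + 3) + 5) + 5"
  by (simp add: main_fm_def num_atoms_alliance_fm num_atoms_bounds_fm)

definition classes_within :: "nat \<Rightarrow> nat \<Rightarrow> vertex_class list \<Rightarrow> bool" where
  "classes_within K n cs \<longleftrightarrow> (\<forall>(u, A, t, m)\<in>set cs. length u = K \<and> length A = K \<and> t \<le> n \<and> m \<le> n)"

text \<open>Class demands contribute at most \<open>n\<close>, and the shift by \<open>e\<close> at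
  most \<open>K\<close>. The remaining \<open>1\<close> leaves room for the constant demand of
  non-emptiness; elsewhere it also covers \<open>Suc n\<close> in the size bounds and a threshold of
  \<open>n + 1\<close>.\<close>

lemma alliance_fm_within:
  "classes_within K n cs \<Longrightarrow> length R = K \<Longrightarrow> atoms_within K (n + K + 1) (alliance_fm R e cs)"
proof (induction R e cs rule: alliance_fm.induct)
  case (1 R e)
  then show ?case using overlap_le_length[of R e] by simp
next
  case (2 R e u A t m cs)
  have overlap: "overlap (inter B R) e \<le> K" for B
    using overlap_le_length[of "inter B R" e] "2.prems"(2) by simp
  then have "d + overlap (inter B R) e \<le> n + K + 1" if "d \<le> n + 1" for d B
    using that overlap by (metis add.assoc add.commute add_mono)
  moreover have "overlap (inter B R) e \<le> n + K" for B
    using overlap by (simp add: trans_le_add2)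
  ultimately show ?case
    using 2 by (auto simp: classes_within_def restricted_atom_def)
qed

lemma no_smaller_fm_within:
  "classes_within K n cs \<Longrightarrow> \<forall>R\<in>set Rs. length R = K \<Longrightarrow> length u = K \<Longrightarrow>
    atoms_within K (n + K + 1) (no_smaller_fm u Rs cs)"
  by (induction Rs) (auto simp: alliance_fm_within[simplified])

lemma bounds_fm_within:
  "classes_within K n all \<Longrightarrow> classes_within K n cs \<Longrightarrow> \<forall>R\<in>set Rs. length R = K \<Longrightarrow>
    atoms_within K (n + K + 1) (bounds_fm Rs all cs)"
  by (induction Rs all cs rule: bounds_fm.induct)
    (auto simp: no_smaller_fm_within[simplified] classes_within_def)

lemma main_fm_within:
  assumes "classes_within (length cs) n cs" "k \<le> n + 1"
  shows "atoms_within (length cs) (n + length cs + 1) (main_fm k cs)"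
  using assms alliance_fm_within[OF assms(1), of "replicate (length cs) True" "[]"]
    bounds_fm_within[OF assms(1,1), of "masks (length cs)"]
  unfolding main_fm_def hd_masks[THEN conjunct2] by (simp add: set_masks)

text \<open>\<open>B\<close> is the bound of \<open>iterate_step_size\<close> for demands up to
  \<open>n + K + 1\<close>; it covers all intermediate lists of formulas at once.\<close>

lemma run_decide:
  fixes cs k n
  defines "K \<equiv> length cs" and "m \<equiv> num_atoms (main_fm k cs)"
  defines "B \<equiv> (K + 1) ^ m * (m * (4 * K + 2 * (n + K + 1) + 10)) + 1"
  assumes cs: "classes_within K n cs" and k: "k \<le> n + 1" and n: "length ts = n"
  shows "prun 31 [encode_list ts, encode_list (map encode_class cs), encode_list (map encode_mask (masks K)),
      encode_unary k] (encode_bool (\<exists>\<phi>\<in>set ((step (masks K) ^^ n) [main_fm k cs]). holds_at_0 \<phi>))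
    (300 * (K + 1) * (K + 1) + (K * (2 ^ K * (300 * (K + 1) * (K + 1) + 50) + 100) + 20)
      + (n * (B * (2 ^ K * (90 * B + 50) + 50) + 50) + 10) + 30 * B + 100)"
proof -
  let ?R = "replicate K True"
  obtain Rs where Rs: "masks K = ?R # Rs" using hd_masks[of K] by (metis list.collapse)
  have cm: "class_masks K cs" using cs by (auto simp: classes_within_def class_masks_def)
  have masks: "\<forall>R\<in>set (masks K). length R = K" by (simp add: set_masks)
  let ?\<phi>s = "\<lambda>i. (step (masks K) ^^ i) [main_fm k cs]"
  have size: "length (?\<phi>s i) \<le> B \<and> nodes_fms (?\<phi>s i) \<le> B \<and> (\<forall>\<phi>\<in>set (?\<phi>s i). nodes (encode_fm \<phi>) \<le> B)" for i
    unfolding B_def m_def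
    using iterate_step_size[OF main_fm_within[OF cs[unfolded K_def] k], folded K_def] .
  have alliance: "prun 16 [encode_mask ?R, Leaf, encode_list (map encode_class cs)]
      (encode_fm (alliance_fm ?R [] cs)) (300 * (K + 1) * (K + 1))"
    using run_alliance[OF cm, of ?R "[]"] by (simp add: K_def)
  have bounds: "prun 18 [encode_list (map encode_mask (masks K)), encode_list (map encode_class cs),
        encode_list (map encode_class cs)] (encode_fm (bounds_fm (masks K) cs cs))
      (K * (2 ^ K * (300 * (K + 1) * (K + 1) + 50) + 100) + 20)"
    using run_bounds[OF cm masks, of cs] by (simp add: K_def)
  have iterate: "prun 23 [encode_list ts, Pair (encode_fm (main_fm k cs)) Leaf, encode_list (map encode_mask (masks K))]
      (encode_list (map encode_fm (?\<phi>s n))) (n * (B * (2 ^ K * (90 * B + 50) + 50) + 50) + 10)"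
    using run_iterate[of ts "masks K" "[main_fm k cs]" B] size n by simp
  have any: "prun 25 [encode_list (map encode_fm (?\<phi>s n))] (encode_bool (\<exists>\<phi>\<in>set (?\<phi>s n). holds_at_0 \<phi>)) (30 * B)"
    by (rule runs_mono[OF run_any]) (use size in simp)
  have left: "left (encode_list (map encode_mask (masks K))) = encode_mask ?R"
    unfolding Rs by simp
  have main: "encode_fm (main_fm k cs) = Pair (Pair (encode_fm (alliance_fm ?R [] cs))
      (Pair (Pair (Pair Leaf (Pair (encode_mask ?R) (encode_unary k))) (encode_fm (bounds_fm (masks K) cs cs)))
        (Pair Leaf (Pair Leaf Leaf)))) (Pair Leaf (Pair Leaf Leaf))"
    unfolding main_fm_def using Rs by (simp flip: K_def)
  show ?thesis
    by (rule runsI, simp add: decide_body_def left del: map_replicate encode_list.simps)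
      (rule wpc_runs[OF alliance], rule wpc_runs[OF bounds], simp add: main[symmetric] del: map_replicate,
       rule wpc_runs[OF iterate], rule wpc_runs[OF any], simp)
qed

text \<open>
  Time bounds are brought into the form \<open>Z ^ i\<close> by the following rules, where \<open>Z\<close> dominates all
  parameters and constants.
\<close>

lemma power_bound_add: "(a::nat) \<le> Z ^ i \<Longrightarrow> b \<le> Z ^ j \<Longrightarrow> 2 \<le> Z \<Longrightarrow> a + b \<le> Z ^ Suc (max i j)"
proof -
  assume "a \<le> Z ^ i" "b \<le> Z ^ j" "2 \<le> Z"
  moreover from this have "Z ^ i \<le> Z ^ max i j" "Z ^ j \<le> Z ^ max i j" by (simp_all add: power_increasing)
  ultimately have "a + b \<le> 2 * Z ^ max i j" by linarith
  also have "\<dots> \<le> Z * Z ^ max i j" using \<open>2 \<le> Z\<close> by (intro mult_right_mono) auto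
  finally show ?thesis by simp
qed

lemma power_bound_mult: "(a::nat) \<le> Z ^ i \<Longrightarrow> b \<le> Z ^ j \<Longrightarrow> a * b \<le> Z ^ (i + j)"
  by (simp add: power_add mult_mono)

lemma power_bound_numeral: "numeral w \<le> (100000::nat) \<Longrightarrow> 100000 \<le> Z \<Longrightarrow> numeral w \<le> (Z::nat) ^ 1"
  unfolding power_one_right by (rule order_trans)

lemma power_bound_one: "2 \<le> Z \<Longrightarrow> (1::nat) \<le> Z ^ 0"
  by simp

lemma power_bound_weaken: "(a::nat) \<le> Z ^ i \<Longrightarrow> i \<le> j \<Longrightarrow> 2 \<le> Z \<Longrightarrow> a \<le> Z ^ j"
  by (meson le_trans one_le_numeral power_increasing)

lemma length_close [simp]: "length (close i rows) = length rows"
  by (induction i rows rule: close.induct) auto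

lemma close_nth: "j < length rows \<Longrightarrow> close i rows ! j = (rows ! j)[i + j := True]"
proof (induction i rows arbitrary: j rule: close.induct)
  case (2 i row rows)
  then show ?case by (cases j) auto
qed simp

lemma nodes_encode_list_le: "\<forall>x\<in>set xs. nodes (f x) + 1 \<le> B \<Longrightarrow> nodes (encode_list (map f xs)) \<le> length xs * B + 1"
  by (induction xs) auto

text \<open>The number \<open>m\<close> of atoms is at most \<open>2 ^ (3 * K + 5)\<close>. Hence
  the number \<open>(K + 1) ^ m\<close> of formulas is at most \<open>2 ^ (K * m)\<close>, and
  \<open>K \<le> 2 ^ K\<close> turns the exponent into \<open>2 ^ (4 * K + 5)\<close>.\<close>

definition fpt_base :: "nat \<Rightarrow> nat" where "fpt_base K = 2 ^ 2 ^ (4 * K + 5)"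

lemma fpt_base_bounds:
  shows "100000 \<le> fpt_base K" "K \<le> fpt_base K" "2 ^ K \<le> fpt_base K"
    and "num_atoms (main_fm k cs) \<le> fpt_base (length cs)"
    and "(length cs + 1) ^ num_atoms (main_fm k cs) \<le> fpt_base (length cs)"
proof -
  have two: "n < 2 ^ n" for n :: nat by (rule less_exp)
  have K: "K < 2 ^ (4 * K + 5)" for K :: nat
    using two[of K] power_increasing[of K "4 * K + 5" "2::nat"] by linarith
  \<comment> \<open>Even for \<open>K = 0\<close> the inner power is \<open>2 ^ 5 = 32\<close>,
    which suffices for the numeric constants.\<close>
  have "(2::nat) ^ 32 \<le> 2 ^ 2 ^ (4 * K + 5)" using power_increasing[of 5 "4 * K + 5" "2::nat"]
    by (intro power_increasing) auto
  then show "100000 \<le> fpt_base K" unfolding fpt_base_def by simp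
  show "2 ^ K \<le> fpt_base K" unfolding fpt_base_def using K[of K] by (intro power_increasing) auto
  then show "K \<le> fpt_base K" using two[of K] by linarith
  let ?K = "length cs" and ?m = "num_atoms (main_fm k cs)"
  define P :: nat where "P = 2 ^ length cs"
  have P: "?K + 1 \<le> P" using two[of ?K] by (simp add: P_def Suc_le_eq)
  have "?m \<le> 4 * P + P * (P * (4 * P + 3 * P) + 5 * P) + 5 * P"
    unfolding num_atoms_main_fm P_def[symmetric] using P by (intro add_mono mult_mono) auto
  also have "\<dots> \<le> 32 * P ^ 3"
  proof -
    have "P \<le> P * P" "P * P \<le> P * P * P" using P by simp_all
    moreover have "4 * P + P * (P * (4 * P + 3 * P) + 5 * P) + 5 * P = 9 * P + 5 * (P * P) + 7 * (P * P * P)"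
      by (simp add: algebra_simps)
    ultimately show ?thesis unfolding power3_eq_cube by linarith
  qed
  also have "\<dots> = 2 ^ (3 * ?K + 5)" by (simp add: P_def power_add power_mult mult.commute)
  finally have m: "?m \<le> 2 ^ (3 * ?K + 5)" .
  have "(?K + 1) ^ ?m \<le> (2 ^ ?K) ^ ?m" using P unfolding P_def by (intro power_mono) auto
  also have "\<dots> = 2 ^ (?K * ?m)" by (simp add: power_mult)
  also have "\<dots> \<le> 2 ^ 2 ^ (4 * ?K + 5)"
  proof (intro power_increasing)
    have "?K * ?m \<le> 2 ^ ?K * 2 ^ (3 * ?K + 5)" using m two[of ?K] by (intro mult_mono) auto
    then show "?K * ?m \<le> 2 ^ (4 * ?K + 5)" by (simp flip: power_add)
  qed simp
  finally show "(?K + 1) ^ ?m \<le> fpt_base ?K" by (simp add: fpt_base_def)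
  have "(2::nat) ^ (3 * ?K + 5) \<le> 2 ^ (4 * ?K + 5)" by (intro power_increasing) auto
  with m show "?m \<le> fpt_base ?K" using two[of "2 ^ (4 * ?K + 5)"] unfolding fpt_base_def by linarith
qed

section \<open>Time of the stages on a graph\<close>

context graph
begin

abbreviation "n \<equiv> length vs"

lemma encode_graph_rows: "encode_graph vs E = encode_list (map encode_mask (map row vs))"
  by (simp add: encode_graph_def row_def o_def)

lemma close_rows: "close 0 (map row vs) = map crow vs"
proof (rule nth_equalityI)
  fix i assume "i < length (close 0 (map row vs))"
  then have i: "i < n" by simp
  have "(row (vs ! i))[i := True] = crow (vs ! i)"
    using i nth_eq_iff_index_eq[OF distinct]
    by (intro nth_equalityI) (auto simp: row_def crow_def nth_list_update)
  then show "close 0 (map row vs) ! i = map crow vs ! i"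
    using i by (simp add: close_nth)
qed simp

lemma map2_key: "map2 (key (map crow vs)) (map row vs) (map crow vs) = keys"
  by (simp add: keys_def vkey_def zip_map_map zip_same_conv_map)

lemma length_rows: "length (row v) = n" "length (crow v) = n" "length (fst (vkey v)) = n"
  by (simp_all add: row_def crow_def fst_vkey)

lemma demand_of_le: "v \<in> V \<Longrightarrow> demand_of v \<le> n"
proof -
  assume v: "v \<in> V"
  have "card (nbhd v) \<le> card V" using nbhd_subset[OF v] by (intro card_mono) auto
  then have "card (nbhd v) \<le> n" using card_length[of vs] by linarith
  then show ?thesis unfolding demand_of_eq[OF v] half_def by auto
qed

lemma K_le: "K \<le> n"
proof -
  have "K = card (set reps)" using distinct_reps by (simp add: distinct_map distinct_card)
  also have "\<dots> \<le> card V" using set_compress[of vs keys] by (intro card_mono) (auto simp: reps_def)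
  finally show ?thesis using card_length[of vs] by linarith
qed

lemma classes_within_cs: "classes_within K n cs"
proof -
  have "mult cs i \<le> n" if "i < K" for i
    unfolding mult_cs[OF that] using card_mono[of V "{v \<in> V. vkey v = vkey (reps ! i)}"] card_length[of vs]
    by simp
  moreover have "demand cs i \<le> n" if "i < K" for i
    unfolding demand_cs[OF that] using demand_of_le reps_subset[OF that] by blast
  ultimately show ?thesis
    unfolding classes_within_def ball_classes using unit_classes_cs by (simp add: unit_classes_def)
qed

lemma nodes_keys: 
  assumes "set ks \<subseteq> vkey ` V"
  shows "nodes (encode_list (map encode_key ks)) \<le> length ks * (6 * n + 4) + 1"
proof (rule nodes_encode_list_le, intro ballI)
  fix \<kappa> assume "\<kappa> \<in> set ks"
  then obtain v where v: "v \<in> V" "\<kappa> = vkey v" using assms by blast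
  then show "nodes (encode_key \<kappa>) + 1 \<le> 6 * n + 4"
    using nodes_encode_mask[of "fst \<kappa>"] demand_of_le[OF v(1)] length_rows[of v]
    by (simp add: encode_key_def demand_of_def)
qed

context
  fixes Z k :: nat
  assumes Z: "fpt_base K \<le> Z" "n \<le> Z" "length (binary_digits k) \<le> Z"
begin

lemma Z_large: "100000 \<le> Z" "2 \<le> Z"
  using fpt_base_bounds(1)[of K] Z(1) by linarith+

lemma bound_leaf: "n \<le> Z ^ 1" "K \<le> Z ^ 1" "length (binary_digits k) \<le> Z ^ 1" "2 ^ K \<le> Z ^ 1"
  "num_atoms (main_fm k' cs) \<le> Z ^ 1" "(K + 1) ^ num_atoms (main_fm k' cs) \<le> Z ^ 1"
  using Z K_le fpt_base_bounds(2,3)[of K] fpt_base_bounds(4,5)[where cs = cs and k = k'] by simp_all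

lemmas bound_rules = bound_leaf power_bound_one[OF Z_large(2)] power_bound_add[OF _ _ Z_large(2)] power_bound_mult

lemma run_close_graph:
  "prun 4 [encode_graph vs E, Leaf] (encode_list (map encode_mask (map crow vs))) (Z ^ 10)"
proof -
  have "n * (20 * (0 + n) + 50) + 10 \<le> Z ^ 10"
    \<comment> \<open>The exponent is left open while the rules follow the structure of the
      expression and assemble it; the final \<open>simp\<close> compares the result with 10.\<close>
    by (rule power_bound_weaken[OF _ _ Z_large(2)], simp only: add_0,
        (rule bound_rules | (rule power_bound_numeral[OF _ Z_large(1)], simp; fail))+, simp)
  then show ?thesis
    using run_close[of "map row vs" 0] runs_mono
    by (simp add: close_rows length_rows encode_graph_rows del: map_map)
qed

lemma nodes_row: "nodes (encode_mask (row v)) \<le> 4 * n + 1" "nodes (encode_mask (crow v)) \<le> 4 * n + 1"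
  using nodes_encode_mask[of "row v"] nodes_encode_mask[of "crow v"] by (simp_all add: length_rows)

lemma nodes_rows_le:
  "nodes (encode_list (map encode_mask (map crow vs))) \<le> n * (4 * n + 2) + 1"
  using nodes_encode_list_le[of "map crow vs" "\<lambda>r. encode_mask r" "4 * n + 2"] nodes_row by simp

lemma run_keys_graph:
  "prun 6 [encode_graph vs E, encode_list (map encode_mask (map crow vs)), encode_list (map encode_mask (map crow vs))]
    (encode_list (map encode_key keys)) (Z ^ 20)"
proof -
  let ?c = "nodes (encode_list (map encode_mask (map crow vs)))"
  have *: "prun 6 [encode_list (map encode_mask (map row vs)), encode_list (map encode_mask (map crow vs)),
      encode_list (map encode_mask (map crow vs))]
    (encode_list (map encode_key (map2 (key (map crow vs)) (map row vs) (map crow vs))))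
    (length (map row vs) * (40 * ?c + 60 * (4 * n + 1) + 100) + 10)"
    by (rule run_keys) (use nodes_row in auto)
  have "length (map row vs) * (40 * ?c + 60 * (4 * n + 1) + 100) + 10
      \<le> n * (40 * (n * (4 * n + 2) + 1) + 60 * (4 * n + 1) + 100) + 10"
    unfolding length_map by (intro add_mono mult_mono nodes_rows_le order_refl zero_le)
  also have "\<dots> \<le> Z ^ 20"
    by (rule power_bound_weaken[OF _ _ Z_large(2)],
        (rule bound_rules | (rule power_bound_numeral[OF _ Z_large(1)], simp; fail))+, simp)
  finally show ?thesis
    using runs_mono[OF *] unfolding map2_key encode_graph_rows by blast
qed

abbreviation "ds \<equiv> compress keys keys"

lemma length_keys: "length keys = n" "length ds \<le> n"
  using K_le unfolding compress_keys by (simp_all add: keys_def)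

lemma nodes_all_keys: "nodes (encode_list (map encode_key keys)) \<le> n * (6 * n + 4) + 1"
  using nodes_keys[of keys] by (simp add: keys_def)

lemma nodes_ds: "nodes (encode_list (map encode_key ds)) \<le> n * (6 * n + 4) + 1"
proof -
  have "set ds \<subseteq> vkey ` V" using set_compress[of keys keys] by (auto simp: keys_def)
  moreover have "length ds * (6 * n + 4) \<le> n * (6 * n + 4)"
    using K_le by (simp add: compress_keys)
  ultimately show ?thesis using nodes_keys[of ds] by linarith
qed

lemma run_compress_graph:
  "prun 7 [encode_list (map encode_key keys), encode_list (map encode_key keys)]
    (encode_list (map encode_key ds)) (Z ^ 20)"
proof (rule runs_mono[OF run_compress_keys])
  have "length keys * (40 * nodes (encode_list (map encode_key keys)) + 50) + 10
      \<le> n * (40 * (n * (6 * n + 4) + 1) + 50) + 10"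
    unfolding length_keys(1) by (intro add_mono mult_mono nodes_all_keys order_refl zero_le)
  also have "\<dots> \<le> Z ^ 20"
    by (rule power_bound_weaken[OF _ _ Z_large(2)],
        (rule bound_rules | (rule power_bound_numeral[OF _ Z_large(1)], simp; fail))+, simp)
  finally show "length keys * (40 * nodes (encode_list (map encode_key keys)) + 50) + 10 \<le> Z ^ 20" .
qed

lemma run_classes_graph:
  "prun 9 [encode_list (map encode_key ds), encode_list (map encode_key ds), encode_list (map encode_key keys)]
    (encode_list (map encode_class cs)) (Z ^ 25)"
proof -
  have "\<forall>\<kappa>\<in>set ds. length (fst \<kappa>) = length keys"
    unfolding compress_keys using length_rows by (auto simp: keys_def)
  note * = run_classes[OF this, of ds, folded cs_def]
  have "length ds * (40 * nodes (encode_list (map encode_key ds))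
        + length keys * (40 * nodes (encode_list (map encode_key keys)) + 50)
        + 40 * nodes (encode_list (map encode_key keys)) + 100) + 10
      \<le> n * (40 * (n * (6 * n + 4) + 1) + n * (40 * (n * (6 * n + 4) + 1) + 50)
        + 40 * (n * (6 * n + 4) + 1) + 100) + 10"
    unfolding length_keys(1)
    by (intro add_mono mult_mono nodes_all_keys nodes_ds length_keys(2) order_refl zero_le)
  also have "\<dots> \<le> Z ^ 25"
    by (rule power_bound_weaken[OF _ _ Z_large(2)],
        (rule bound_rules | (rule power_bound_numeral[OF _ Z_large(1)], simp; fail))+, simp)
  finally show ?thesis by (rule runs_mono[OF *])
qed

lemma run_masks_graph:
  "prun 11 [encode_list (map encode_key ds)] (encode_list (map encode_mask (masks K))) (Z ^ 5)"
proof -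
  have "200 * 2 ^ K \<le> Z ^ 5"
    by (rule power_bound_weaken[OF _ _ Z_large(2)],
        (rule bound_rules | (rule power_bound_numeral[OF _ Z_large(1)], simp; fail))+, simp)
  then show ?thesis using run_masks[of "map encode_key ds"] by (simp add: compress_keys runs_mono)
qed

text \<open>The extra \<open>Leaf\<close> in front of the rows sets the cap to \<open>n + 1\<close>.
  Capping at \<open>n\<close> would make the unattainable threshold \<open>n + 1\<close> look like
  \<open>n\<close>.\<close>

lemma run_value_graph:
  "prun 29 [encode_binary k, Pair Leaf (encode_graph vs E)] (encode_unary (min k (n + 1))) (Z ^ 10)"
proof -
  have "length (binary_digits k) * (40 * (n + 1) + 100) + 10 \<le> Z ^ 10"
    by (rule power_bound_weaken[OF _ _ Z_large(2)],
        (rule bound_rules | (rule power_bound_numeral[OF _ Z_large(1)], simp; fail))+, simp)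
  moreover have "prun 29 [encode_binary k, Pair Leaf (encode_graph vs E)] (encode_unary (min k (n + 1)))
      (length (binary_digits k) * (40 * (n + 1) + 100) + 10)"
    using run_value[of "binary_digits k" "Leaf # map encode_mask (map row vs)"]
    by (simp add: encode_binary_def encode_graph_rows bits_value_binary_digits)
  ultimately show ?thesis by (metis runs_mono)
qed

lemma run_decide_graph:
  "prun 31 [encode_graph vs E, encode_list (map encode_class cs), encode_list (map encode_mask (masks K)),
      encode_unary (min k (n + 1))]
    (encode_bool (\<exists>S. globally_minimal_defensive_alliance V E S \<and> k \<le> card S)) (Z ^ 60)"
proof -
  have card: "k \<le> card S \<longleftrightarrow> min k (n + 1) \<le> card S" if "globally_minimal_defensive_alliance V E S" for S
  proof -
    have "card S \<le> card V"
      using that by (intro card_mono) (auto simp: globally_minimal_defensive_alliance_def defensive_alliance_def)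
    then show ?thesis using card_length[of vs] by auto
  qed
  have "(\<exists>\<phi>\<in>set ((step (masks K) ^^ n) [main_fm (min k (n + 1)) cs]). holds_at_0 \<phi>) \<longleftrightarrow>
      (\<exists>x. (\<forall>i\<ge>K. x i = 0) \<and> (\<forall>i. x i < 2 ^ n) \<and> sat x (main_fm (min k (n + 1)) cs))"
    unfolding iterate_step_correct list.set bex_simps(5,7) by blast
  also have "\<dots> \<longleftrightarrow> (\<exists>S. globally_minimal_defensive_alliance V E S \<and> min k (n + 1) \<le> card S)"
    by (rule sat_main_fm_iff)
  also have "\<dots> \<longleftrightarrow> (\<exists>S. globally_minimal_defensive_alliance V E S \<and> k \<le> card S)"
    using card by blast
  finally have correct: "(\<exists>\<phi>\<in>set ((step (masks K) ^^ n) [main_fm (min k (n + 1)) cs]). holds_at_0 \<phi>) \<longleftrightarrow>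
      (\<exists>S. globally_minimal_defensive_alliance V E S \<and> k \<le> card S)" .
  note * = run_decide[OF classes_within_cs[folded length_cs], of "min k (n + 1)" "map encode_mask (map row vs)",
      unfolded length_cs correct, folded encode_graph_rows, simplified length_map, OF _ refl]
  show ?thesis
    by (rule runs_mono[OF *], simp, rule power_bound_weaken[OF _ _ Z_large(2)],
        (rule bound_rules | (rule power_bound_numeral[OF _ Z_large(1)], simp; fail))+, simp)
qed

end

end

context graph
begin

lemma run_main:
  fixes Z k :: nat
  assumes Z: "fpt_base K \<le> Z" "n \<le> Z" "length (binary_digits k) \<le> Z"
  shows "prun 0 [Pair (encode_graph vs E) (encode_binary k)]
    (encode_bool (\<exists>S. globally_minimal_defensive_alliance V E S \<and> k \<le> card S)) (Z ^ 64)"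
proof -
  note Z_large = Z_large[OF Z]
  define W where "W = Z ^ 60"
  have W: "Z ^ i \<le> W" if "i \<le> 60" for i
    unfolding W_def using that Z_large by (intro power_increasing) auto
  have W1: "100 \<le> W" using W[of 1] Z_large(1) by simp
  have runs_W: "prun i us v (Z ^ j) \<Longrightarrow> j \<le> 60 \<Longrightarrow> prun i us v W" for i us v j
    using W runs_mono by blast
  note close = runs_W[OF run_close_graph[OF Z]]
    and keys = runs_W[OF run_keys_graph[OF Z]]
    and compress = runs_W[OF run_compress_graph[OF Z]]
    and classes = runs_W[OF run_classes_graph[OF Z]]
    and masks = runs_W[OF run_masks_graph[OF Z]]
    and val = runs_W[OF run_value_graph[OF Z]]
    and decide = runs_W[OF run_decide_graph[OF Z]]
  \<comment> \<open>Seven calls, three of them to \<open>compress\<close>, cost at most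
    \<open>W\<close> each; the other two \<open>W\<close> absorb the constant overhead.\<close>
  have solve: "prun 30 [encode_graph vs E, encode_list (map encode_key local.keys), encode_binary k]
      (encode_bool (\<exists>S. globally_minimal_defensive_alliance V E S \<and> k \<le> card S)) (9 * W)"
    using W1 by (intro runsI) (auto simp: solve_body_def intro!: wpc_runs[OF compress] wpc_runs[OF classes]
        wpc_runs[OF masks] wpc_runs[OF val] wpc_runs[OF decide])
  \<comment> \<open>Two closings, one computation of keys and the \<open>9 * W\<close> from above
    make twelve \<open>W\<close>; the last one absorbs the overhead.\<close>
  have "prun 0 [Pair (encode_graph vs E) (encode_binary k)]
    (encode_bool (\<exists>S. globally_minimal_defensive_alliance V E S \<and> k \<le> card S)) (13 * W)"
    using W1 by (intro runsI) (auto simp: main_body_def simp del: map_map intro!: wpc_runs[OF close] wpc_runs[OF keys]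
        wpc_runs[OF solve])
  moreover have "13 * W \<le> Z ^ 64"
    unfolding W_def using mult_mono[of 13 "Z ^ 4" "Z ^ 60" "Z ^ 60"] Z_large power_increasing[of 1 4 Z]
    by (simp flip: power_add)
  ultimately show ?thesis by (rule runs_mono)
qed

end

section \<open>A computable bound for the dependence on the parameter\<close>

definition exp_program :: program where
  "exp_program = [Call 1 [Call 1 [Call 1 [PairE LeafE (PairE LeafE (PairE LeafE (PairE LeafE a0)))]]],
    IfPair a0 (Call 2 [Call 1 [RightE a0], Call 1 [RightE a0]]) TrueE,
    IfPair a0 (PairE LeafE (Call 2 [RightE a0, a1])) a1]"

lemma exp_program_nth [simp]:
  "length exp_program = 3"
  "exp_program ! 0 = Call 1 [Call 1 [Call 1 [PairE LeafE (PairE LeafE (PairE LeafE (PairE LeafE a0)))]]]"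
  "exp_program ! Suc 0 = IfPair a0 (Call 2 [Call 1 [RightE a0], Call 1 [RightE a0]]) TrueE"
  "exp_program ! 2 = IfPair a0 (PairE LeafE (Call 2 [RightE a0, a1])) a1"
  by (simp_all add: exp_program_def)

lemma exp_append: "\<exists>T. runs exp_program 2 [encode_unary m, encode_unary n] (encode_unary (m + n)) T"
proof (induction m)
  case 0
  show ?case by (rule exI[of _ 10], rule runsI) simp
next
  case (Suc m)
  then obtain T where T: "runs exp_program 2 [encode_unary m, encode_unary n] (encode_unary (m + n)) T" ..
  show ?case by (rule exI[of _ "T + 20"], rule runsI) (auto intro!: wpc_runs[OF T])
qed

lemma exp_power: "\<exists>T. runs exp_program (Suc 0) [encode_unary m] (encode_unary (2 ^ m)) T"
proof (induction m)
  case 0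
  show ?case by (rule exI[of _ 10], rule runsI) simp
next
  case (Suc m)
  then obtain T where T: "runs exp_program (Suc 0) [encode_unary m] (encode_unary (2 ^ m)) T" ..
  obtain T' where T': "runs exp_program 2 [encode_unary (2 ^ m), encode_unary (2 ^ m)] (encode_unary (2 ^ m + 2 ^ m)) T'"
    using exp_append by blast
  have double: "(2::nat) ^ Suc m = 2 ^ m + 2 ^ m" by simp
  show ?case
    unfolding double by (rule exI[of _ "T + T + T' + 20"], rule runsI)
      (auto intro!: wpc_runs[OF T] wpc_runs[OF T'])
qed

text \<open>This tower needs no arithmetic beyond adding 4 and iterating the exponential on unary
  numbers, yet it dominates the parameter-dependent factor of the running time.\<close>

lemma computable_exp: "computable (\<lambda>k. 2 ^ 2 ^ 2 ^ (k + 4))"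
  unfolding computable_def computes_def
proof (intro exI[of _ exp_program] allI)
  fix k
  obtain T1 where T1: "runs exp_program (Suc 0) [encode_unary (Suc (Suc (Suc (Suc k))))] (encode_unary (2 ^ (k + 4))) T1"
    using exp_power[of "k + 4"] by (auto simp: numeral_eq_Suc)
  obtain T2 where T2: "runs exp_program (Suc 0) [encode_unary (2 ^ (k + 4))] (encode_unary (2 ^ 2 ^ (k + 4))) T2"
    using exp_power by blast
  obtain T3 where T3: "runs exp_program (Suc 0) [encode_unary (2 ^ 2 ^ (k + 4))] (encode_unary (2 ^ 2 ^ 2 ^ (k + 4))) T3"
    using exp_power by blast
  have "runs exp_program 0 [encode_unary k] (encode_unary (2 ^ 2 ^ 2 ^ (k + 4))) (T1 + T2 + T3 + 50)"
    by (intro runsI) (auto intro!: wpc_runs[OF T1[simplified]] wpc_runs[OF T2] wpc_runs[OF T3])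
  then show "\<exists>t. exp_program \<noteq> [] \<and>
      eval exp_program [encode_unary k] (exp_program ! 0) (encode_unary (2 ^ 2 ^ 2 ^ (k + 4))) t"
    unfolding runs_def by (metis exp_program_nth(1) length_0_conv zero_neq_numeral)
qed

text \<open>As \<open>64 = 2 ^ 6\<close>, the power raises the exponent \<open>4 * K + 5\<close> to
  \<open>4 * K + 11\<close>; the third exponential absorbs this linear term.\<close>

lemma fpt_base_power: "K \<le> k \<Longrightarrow> fpt_base K ^ 64 \<le> 2 ^ 2 ^ 2 ^ (k + 4)"
proof -
  assume "K \<le> k"
  have "4 * K + 11 \<le> 16 * (K + 1)" by simp
  also have "\<dots> \<le> 16 * 2 ^ k"
    using less_exp[of k] \<open>K \<le> k\<close> by (intro mult_left_mono) linarith+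
  also have "\<dots> = 2 ^ (k + 4)" by (simp add: power_add)
  finally have "(2::nat) ^ 2 ^ (4 * K + 11) \<le> 2 ^ 2 ^ 2 ^ (k + 4)"
    by (intro power_increasing) auto
  moreover have "fpt_base K ^ 64 = 2 ^ 2 ^ (4 * K + 11)"
    by (simp add: fpt_base_def power_add flip: power_mult)
  ultimately show ?thesis by simp
qed

theorem theorem1:
  "fixed_parameter_tractable alliance_instances encode_alliance_instance
     has_large_globally_minimal_defensive_alliance instance_neighbourhood_diversity"
  unfolding fixed_parameter_tractable_def
proof (rule exI[of _ alliance_program], rule exI[of _ "\<lambda>k. 2 ^ 2 ^ 2 ^ (k + 4)"], rule exI[of _ 64],
    intro conjI ballI)
  show "computable (\<lambda>k. 2 ^ 2 ^ 2 ^ (k + 4))" by (rule computable_exp)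
  fix x assume "x \<in> alliance_instances"
  then obtain vs E k where x: "x = (vs, E, k)" "distinct vs" "simple_graph (set vs) E"
    by (auto simp: alliance_instances_def)
  interpret graph vs E using x by unfold_locales
  let ?N = "nodes (encode_alliance_instance x)"
  have N: "length vs \<le> ?N" "length (binary_digits k) \<le> ?N" "1 \<le> ?N"
    using length_le_nodes[of "map (\<lambda>r. encode_mask r) (map row vs)"]
      length_le_nodes[of "map encode_bool (binary_digits k)"]
    by (simp_all add: x encode_graph_rows encode_binary_def del: map_map)
  \<comment> \<open>A product dominates both factors, and its 64th power splits into a part for the
    parameter and a part for the input size.\<close>
  let ?Z = "fpt_base K * ?N"
  have f: "1 \<le> fpt_base K" using fpt_base_bounds(1)[of K] by linarith
  have Z: "fpt_base K \<le> ?Z" "length vs \<le> ?Z" "length (binary_digits k) \<le> ?Z"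
    using N f mult_le_mono[of 1 "fpt_base K" _ ?N] by auto
  obtain t where t: "t \<le> ?Z ^ 64" "eval alliance_program [encode_alliance_instance x]
      (alliance_program ! 0) (encode_bool (has_large_globally_minimal_defensive_alliance x)) t"
    using run_main[OF Z] by (auto simp: runs_def x)
  \<comment> \<open>The running time is governed by the number \<open>K\<close> of keys; since
    \<open>K\<close> is at most the neighbourhood diversity, the bound can be evaluated at the
    latter.\<close>
  have "?Z ^ 64 \<le> 2 ^ 2 ^ 2 ^ (instance_neighbourhood_diversity x + 4) * ?N ^ 64"
    unfolding power_mult_distrib using K_le_neighbourhood_diversity
    by (intro mult_right_mono fpt_base_power) (simp_all add: x)
  with t show "\<exists>t. computes alliance_program (encode_alliance_instance x)
      (encode_bool (has_large_globally_minimal_defensive_alliance x)) t \<and>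
      t \<le> 2 ^ 2 ^ 2 ^ (instance_neighbourhood_diversity x + 4) * ?N ^ 64"
    unfolding computes_def by (intro exI[of _ t]) (auto simp: alliance_program_def)
qed

end
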